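(* There is a polynomial-time $5$-approximation algorithm for the lower-bounded $k$-supplier with outliers problem (defined in the context): on every instance admitting a feasible solution it returns a feasible solution of cost at most $5$ times the optimal cost.
   Context: Lower-bounded $k$-supplier with outliers: the input is a finite facility set $\mathcal F$ and a finite client set $\mathcal D$ in a common metric space with distances $c(i,j)$, nonnegative integer lower bounds $\{L_i\}_{i\in\mathcal F}$, and nonnegative integers $k,m$. A feasible solution is a pair $(S,\sigma)$ with $S\subseteq\mathcal F$, $|S|\le k$, $\sigma:\mathcal D\to S\cup\{\mathsf{out}\}$, $|\sigma^{-1}(i)|\ge L_i$ for all $i\in S$, and $|\sigma^{-1}(\mathsf{out})|\le m$. Its cost is $\max_{i\in S}\max_{j\in\sigma^{-1}(i)}c(i,j)$, to be minimized. *)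

theory Defs
  imports Complex_Main "HOL-Library.Log_Nat" "HOL-Computational_Algebra.Polynomial"
begin

section \<open>Lower-bounded k-supplier with outliers\<close>

text \<open>
  Facilities are \<open>0, \<dots>, nfac I - 1\<close> and clients \<open>0, \<dots>, ncli I - 1\<close>. Distances are rational, so
  that an instance is a finite object with a bit length.
\<close>

datatype point = Fac nat | Cli nat

record lbkso =
  nfac :: nat
  ncli :: nat
  budget :: nat
  outliers :: nat
  lower :: "nat \<Rightarrow> nat"
  dst :: "point \<Rightarrow> point \<Rightarrow> rat"

definition points :: "lbkso \<Rightarrow> point set" where
  "points I = Fac ` {..<nfac I} \<union> Cli ` {..<ncli I}"

text \<open>
  Different names may denote the same point of the underlying metric space (a facility may sit at
  the location of a client), so distinct names are allowed to have distance 0.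
\<close>

definition valid :: "lbkso \<Rightarrow> bool" where
  "valid I \<longleftrightarrow>
     (\<forall>x\<in>points I. dst I x x = 0) \<and>
     (\<forall>x\<in>points I. \<forall>y\<in>points I. 0 \<le> dst I x y \<and> dst I x y = dst I y x) \<and>
     (\<forall>x\<in>points I. \<forall>y\<in>points I. \<forall>z\<in>points I. dst I x z \<le> dst I x y + dst I y z)"

text \<open>
  An assignment is a partial map; the clients mapped to \<^const>\<open>None\<close> are the outliers.
\<close>

definition feasible :: "lbkso \<Rightarrow> nat set \<Rightarrow> (nat \<rightharpoonup> nat) \<Rightarrow> bool" where
  "feasible I S \<sigma> \<longleftrightarrow>
     S \<subseteq> {..<nfac I} \<and> card S \<le> budget I \<and>
     dom \<sigma> \<subseteq> {..<ncli I} \<and> ran \<sigma> \<subseteq> S \<and>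
     (\<forall>i\<in>S. lower I i \<le> card {j. j < ncli I \<and> \<sigma> j = Some i}) \<and>
     card {j. j < ncli I \<and> \<sigma> j = None} \<le> outliers I"

text \<open>Inserting 0 makes the cost of a solution that assigns no client equal to 0.\<close>

definition cost :: "lbkso \<Rightarrow> nat set \<Rightarrow> (nat \<rightharpoonup> nat) \<Rightarrow> rat" where
  "cost I S \<sigma> =
     Max (insert 0 {dst I (Fac i) (Cli j) | i j. i \<in> S \<and> j < ncli I \<and> \<sigma> j = Some i})"

definition opt_cost :: "lbkso \<Rightarrow> rat" where
  "opt_cost I = Min {cost I S \<sigma> | S \<sigma>. feasible I S \<sigma>}"

lemma finite_feasible: "finite {(S, \<sigma>). feasible I S \<sigma>}"
proof (rule finite_subset)
  show "{(S, \<sigma>). feasible I S \<sigma>} \<subseteq>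
    Pow {..<nfac I} \<times> (\<Union>A\<in>Pow {..<ncli I}. {\<sigma>. dom \<sigma> = A \<and> ran \<sigma> \<subseteq> {..<nfac I}})"
    by (auto simp: feasible_def)
  show "finite (Pow {..<nfac I} \<times> (\<Union>A\<in>Pow {..<ncli I}. {\<sigma>. dom \<sigma> = A \<and> ran \<sigma> \<subseteq> {..<nfac I}}))"
    by (intro finite_cartesian_product finite_UN_I finite_Pow_iff[THEN iffD2] finite_lessThan
          finite_set_of_finite_maps) (auto intro: finite_subset)
qed

lemma finite_costs: "finite {cost I S \<sigma> | S \<sigma>. feasible I S \<sigma>}"
proof -
  have "{cost I S \<sigma> | S \<sigma>. feasible I S \<sigma>} = (\<lambda>(S, \<sigma>). cost I S \<sigma>) ` {(S, \<sigma>). feasible I S \<sigma>}"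
    by auto
  then show ?thesis
    using finite_feasible by simp
qed

lemma opt_cost_le: "feasible I S \<sigma> \<Longrightarrow> opt_cost I \<le> cost I S \<sigma>"
  unfolding opt_cost_def by (rule Min_le[OF finite_costs]) blast

lemma opt_cost_attained:
  assumes "feasible I S \<sigma>"
  obtains S' \<sigma>' where "feasible I S' \<sigma>'" "opt_cost I = cost I S' \<sigma>'"
proof -
  have "opt_cost I \<in> {cost I S \<sigma> | S \<sigma>. feasible I S \<sigma>}"
    unfolding opt_cost_def by (rule Min_in[OF finite_costs]) (use assms in blast)
  then show ?thesis
    using that by blast
qed

section \<open>Random access machine with logarithmic cost\<close>

text \<open>
  Structured programs over an unbounded memory of natural numbers, organised in arrays. Every
  operation is charged the bit lengths of its addresses and operands, and of the values read or written.
  This logarithmic cost measure is polynomially related to Turing machine time, also in the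
  presence of multiplication. Scalar variables are arrays used at index 0 only.
\<close>

type_synonym mem = "nat \<Rightarrow> nat \<Rightarrow> nat"

datatype aexp =
    Const nat
  | Read nat aexp
  | Add aexp aexp
  | Sub aexp aexp
  | Mul aexp aexp

datatype com =
    Skip
  | Write nat aexp aexp
  | Seq com com
  | Cond aexp com com
  | While aexp com

fun aval :: "aexp \<Rightarrow> mem \<Rightarrow> nat" where
  "aval (Const n) s = n"
| "aval (Read a e) s = s a (aval e s)"
| "aval (Add e f) s = aval e s + aval f s"
| "aval (Sub e f) s = aval e s - aval f s"
| "aval (Mul e f) s = aval e s * aval f s"

definition len :: "nat \<Rightarrow> nat" where
  "len n = floorlog 2 n + 1"

fun atime :: "aexp \<Rightarrow> mem \<Rightarrow> nat" where
  "atime (Const n) s = len n"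
| "atime (Read a e) s = atime e s + len (aval e s) + len (s a (aval e s))"
| "atime (Add e f) s = atime e s + atime f s + len (aval e s) + len (aval f s)"
| "atime (Sub e f) s = atime e s + atime f s + len (aval e s) + len (aval f s)"
| "atime (Mul e f) s = atime e s + atime f s + len (aval e s) + len (aval f s)"

text \<open>
  \<open>exec c s t s'\<close>: started in memory \<open>s\<close>, the program \<open>c\<close> halts after time \<open>t\<close> in memory \<open>s'\<close>.
  A test succeeds iff its value is nonzero.
\<close>

inductive exec :: "com \<Rightarrow> mem \<Rightarrow> nat \<Rightarrow> mem \<Rightarrow> bool" where
  Skip: "exec Skip s 1 s"
| Write: "exec (Write a e f) s
            (atime e s + atime f s + len (aval e s) + len (aval f s))
            (s(a := (s a)(aval e s := aval f s)))"
| Seq: "exec c s t s' \<Longrightarrow> exec d s' u s'' \<Longrightarrow> exec (Seq c d) s (t + u) s''"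
| IfTrue: "aval e s \<noteq> 0 \<Longrightarrow> exec c s t s' \<Longrightarrow> exec (Cond e c d) s (atime e s + len (aval e s) + t) s'"
| IfFalse: "aval e s = 0 \<Longrightarrow> exec d s t s' \<Longrightarrow> exec (Cond e c d) s (atime e s + len (aval e s) + t) s'"
| WhileFalse: "aval e s = 0 \<Longrightarrow> exec (While e c) s (atime e s + len (aval e s)) s"
| WhileTrue: "aval e s \<noteq> 0 \<Longrightarrow> exec c s t s' \<Longrightarrow> exec (While e c) s' u s'' \<Longrightarrow>
    exec (While e c) s (atime e s + len (aval e s) + t + u) s''"

inductive_cases SkipE: "exec Skip s t s'"
inductive_cases WriteE: "exec (Write a e f) s t s'"
inductive_cases SeqE: "exec (Seq c d) s t s'"
inductive_cases IfE: "exec (Cond e c d) s t s'"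
inductive_cases WhileE: "exec (While e c) s t s'"

lemma exec_deterministic:
  "exec c s t s' \<Longrightarrow> exec c s u s'' \<Longrightarrow> t = u \<and> s' = s''"
proof (induction arbitrary: u s'' rule: exec.induct)
  case (Skip s)
  from Skip.prems show ?case by (rule SkipE) simp
next
  case (Write a e s f)
  from Write.prems show ?case by (rule WriteE) simp
next
  case (Seq c s t s1 d v s2)
  from Seq.prems show ?case by (rule SeqE) (auto dest!: Seq.IH)
next
  case (IfTrue e s c t s' d)
  from IfTrue.prems show ?case by (rule IfE) (use IfTrue.hyps in \<open>auto dest!: IfTrue.IH\<close>)
next
  case (IfFalse e s d t s' c)
  from IfFalse.prems show ?case by (rule IfE) (use IfFalse.hyps in \<open>auto dest!: IfFalse.IH\<close>)
next
  case (WhileFalse e s c)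
  from WhileFalse.prems show ?case by (rule WhileE) (use WhileFalse.hyps in auto)
next
  case (WhileTrue e s c t s1 v s2)
  from WhileTrue.prems show ?case by (rule WhileE) (use WhileTrue.hyps in \<open>auto dest!: WhileTrue.IH\<close>)
qed

section \<open>Input and output\<close>

definition encode_rat :: "rat \<Rightarrow> nat list" where
  "encode_rat q = (case quotient_of q of (a, b) \<Rightarrow> [nat a, nat b])"

definition encode :: "lbkso \<Rightarrow> nat list" where
  "encode I =
     (let ps = map Fac [0..<nfac I] @ map Cli [0..<ncli I] in
      [nfac I, ncli I, budget I, outliers I] @ map (lower I) [0..<nfac I] @
      concat (map (\<lambda>x. concat (map (\<lambda>y. encode_rat (dst I x y)) ps)) ps))"

definition input_size :: "lbkso \<Rightarrow> nat" where
  "input_size I = sum_list (map len (encode I))"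

text \<open>
  The input is stored in array 0; the output is read from array 1 (indicator of the set of open
  facilities) and array 2 (0 for an outlier, \<open>i + 1\<close> for a client assigned to facility \<open>i\<close>).
\<close>

definition init_mem :: "nat list \<Rightarrow> mem" where
  "init_mem xs = (\<lambda>a i. if a = 0 \<and> i < length xs then xs ! i else 0)"

definition out_set :: "lbkso \<Rightarrow> mem \<Rightarrow> nat set" where
  "out_set I s = {i. i < nfac I \<and> s 1 i \<noteq> 0}"

definition out_assign :: "lbkso \<Rightarrow> mem \<Rightarrow> (nat \<rightharpoonup> nat)" where
  "out_assign I s = (\<lambda>j. if j < ncli I \<and> s 2 j \<noteq> 0 then Some (s 2 j - 1) else None)"

end

theory Submission
  imports Defs
begin

text \<open>
  Fix a guess \<open>\<tau>\<close> of the optimal cost and let \<open>\<Gamma>(i)\<close> be the set of clients within \<open>\<tau>\<close> of facility \<open>i\<close>.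
  Among the facilities with \<open>L\<^sub>i \<le> |\<Gamma>(i)|\<close> at distance more than \<open>4\<tau>\<close> from all facilities chosen so far,
  repeatedly choose one with the largest \<open>|\<Gamma>(i)|\<close>, at most \<open>k\<close> in total. If \<open>\<tau>\<close> is at least the optimum,
  then some solution of cost at most \<open>\<tau>\<close> always has an open facility within \<open>2\<tau>\<close> of each chosen one: should
  \<open>i\<close> violate this, its clients \<open>\<Gamma>(i)\<close> are all outliers, and exchanging an uncovered open facility for \<open>i\<close>
  does not increase the number of outliers, by the choice of \<open>i\<close>. In the end every open facility is within
  \<open>4\<tau>\<close> of a chosen one, so every served client is within \<open>5\<tau>\<close>; the disjoint sets \<open>\<Gamma>(i)\<close> provide the lower
  bounds. The candidates for \<open>\<tau>\<close> are the facility-client distances.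
\<close>

section \<open>Bit lengths and expression cost\<close>

text \<open>The constants interlock. A client of \<Gamma>(i) served by i' puts i' within 2\<tau> of
  i, so without such an i' all of \<Gamma>(i) is unserved. Chosen facilities more than 4\<tau> apart
  cannot share an open facility within 2\<tau>, so a packing of size k accounts for every open one.
  An open facility beyond 4\<tau> from the packing is nobody's partner, so it can be given up; it is
  also a candidate itself, which is what makes the greedy comparison apply to it. Nothing is claimed
  for a radius without a solution. The program keeps the smallest radius at which the packing leaves
  few enough clients uncovered, and this radius is at most the optimum. The obstacle is the running
  time under logarithmic cost. It is separated from correctness: programs are written in a loop
  language whose syntax alone enforces polynomial time, and the invariants never mention time. The
  budget is a number in binary, possibly exponential in the input size, so the greedy runs one round
  per facility rather than counting up to the budget.\<close>

lemma poly_nat_mono: "x \<le> y \<Longrightarrow> poly (p :: nat poly) x \<le> poly p y"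
  by (induction p) (auto intro: add_mono mult_mono)

lemma len_le_iff: "len n \<le> Suc w \<longleftrightarrow> n < 2 ^ w"
  by (simp add: len_def floorlog_le_iff)

lemma less_two_power_len: "n < 2 ^ (len n - 1)"
  using len_le_iff[of n "len n - 1"] by (simp add: len_def)

lemma len_pos: "1 \<le> len n"
  by (simp add: len_def)

lemma len_mono: "m \<le> n \<Longrightarrow> len m \<le> len n"
  by (simp add: len_def floorlog_mono)

lemma len_mult: "len (m * n) \<le> len m + len n"
proof -
  have "m * n < 2 ^ (len m - 1) * 2 ^ (len n - 1)"
    by (intro mult_strict_mono less_two_power_len) auto
  also have "\<dots> \<le> 2 ^ (len m + len n - 1)"
    using len_pos[of m] len_pos[of n] by (simp flip: power_add)
  finally show ?thesis
    using len_le_iff[of "m * n" "len m + len n - 1"] len_pos[of m] by simp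
qed

lemma len_add: "len (m + n) \<le> len m + len n"
proof -
  let ?a = "len m - 1" and ?b = "len n - 1"
  have "m + n < 2 ^ ?a + 2 ^ ?b"
    by (intro add_strict_mono less_two_power_len)
  also have "\<dots> \<le> 2 ^ (?a + ?b) + 2 ^ (?a + ?b)"
    by (intro add_mono power_increasing) auto
  also have "\<dots> = 2 ^ (len m + len n - 1)"
    using len_pos[of m] len_pos[of n] by (cases "len m"; cases "len n") auto
  finally show ?thesis
    using len_le_iff[of "m + n" "len m + len n - 1"] len_pos[of m] by simp
qed

lemma len_le_Suc: "len n \<le> Suc n"
  by (simp add: len_le_iff)

lemma len_add_le: "len (m + n) \<le> len m + Suc n"
  using len_add[of m n] len_le_Suc[of n] by linarith

text \<open>The length of the value is bounded together with the time because the enclosing node is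
  charged for it. Sums and products have at most the total length of their operands, so each binary
  node at most doubles the bound.\<close>

lemma aexp_poly_time:
  "\<exists>q :: nat poly. \<forall>s M. (\<forall>a i. s a i \<le> M) \<longrightarrow> atime e s + len (aval e s) \<le> poly q (len M)"
proof (induction e)
  case (Const n)
  show ?case by (rule exI[of _ "[:2 * len n:]"]) simp
next
  case (Read a e)
  then obtain q :: "nat poly" where
    q: "atime e s + len (aval e s) \<le> poly q (len M)" if "\<forall>a i. s a i \<le> M" for s M
    by blast
  have "atime (Read a e) s + len (aval (Read a e) s) \<le> poly (q + [:0, 2:]) (len M)"
    if "\<forall>a i. s a i \<le> M" for s M
    using q[OF that] len_mono[of "s a (aval e s)" M] that by simp
  then show ?case by blast
next
  case (Add e f)
  then obtain p q :: "nat poly" where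
    p: "atime e s + len (aval e s) \<le> poly p (len M)" and
    q: "atime f s + len (aval f s) \<le> poly q (len M)" if "\<forall>a i. s a i \<le> M" for s M
    by metis
  have "atime (Add e f) s + len (aval (Add e f) s) \<le> poly (smult 2 (p + q)) (len M)"
    if "\<forall>a i. s a i \<le> M" for s M
    using p[OF that] q[OF that] len_add[of "aval e s" "aval f s"] by simp
  then show ?case by blast
next
  case (Sub e f)
  then obtain p q :: "nat poly" where
    p: "atime e s + len (aval e s) \<le> poly p (len M)" and
    q: "atime f s + len (aval f s) \<le> poly q (len M)" if "\<forall>a i. s a i \<le> M" for s M
    by metis
  have "atime (Sub e f) s + len (aval (Sub e f) s) \<le> poly (smult 2 (p + q)) (len M)"
    if "\<forall>a i. s a i \<le> M" for s M
    using p[OF that] q[OF that] len_mono[of "aval e s - aval f s" "aval e s"] by simp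
  then show ?case by blast
next
  case (Mul e f)
  then obtain p q :: "nat poly" where
    p: "atime e s + len (aval e s) \<le> poly p (len M)" and
    q: "atime f s + len (aval f s) \<le> poly q (len M)" if "\<forall>a i. s a i \<le> M" for s M
    by metis
  have "atime (Mul e f) s + len (aval (Mul e f) s) \<le> poly (smult 2 (p + q)) (len M)"
    if "\<forall>a i. s a i \<le> M" for s M
    using p[OF that] q[OF that] len_mult[of "aval e s" "aval f s"] by simp
  then show ?case by blast
qed

section \<open>Loop programs\<close>

text \<open>
  \<open>LFor v b c\<close> runs \<open>c\<close> for each value of the scalar \<open>v\<close> below the input cell \<open>b\<close>. Since loop bounds
  are input cells that no program overwrites, and stored values grow only by additive constants,
  every well-formed loop program runs in polynomial time for purely syntactic reasons.
\<close>

datatype lprog =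
    LSkip
  | LWrite nat aexp aexp
  | LSeq lprog lprog
  | LCond aexp lprog lprog
  | LFor nat nat lprog

definition upd :: "nat \<Rightarrow> nat \<Rightarrow> nat \<Rightarrow> mem \<Rightarrow> mem" where
  "upd a i x s = s(a := (s a)(i := x))"

text \<open>The final write in the \<open>LFor\<close> clause mirrors the compiled loop, whose
  counter stops at the bound.\<close>

primrec run :: "lprog \<Rightarrow> mem \<Rightarrow> mem" where
  "run LSkip = (\<lambda>s. s)"
| "run (LWrite a e f) = (\<lambda>s. upd a (aval e s) (aval f s) s)"
| "run (LSeq c d) = (\<lambda>s. run d (run c s))"
| "run (LCond e c d) = (\<lambda>s. if aval e s \<noteq> 0 then run c s else run d s)"
| "run (LFor v b c) =
    (\<lambda>s. upd v 0 (s 0 b) (fold (\<lambda>i s. run c (upd v 0 i s)) [0..<s 0 b] s))"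

primrec writes :: "lprog \<Rightarrow> nat set" where
  "writes LSkip = {}"
| "writes (LWrite a e f) = {a}"
| "writes (LSeq c d) = writes c \<union> writes d"
| "writes (LCond e c d) = writes c \<union> writes d"
| "writes (LFor v b c) = insert v (writes c)"

text \<open>The machine has no comparison: the truncated difference of bound and counter is nonzero
  exactly while the counter is below the bound.\<close>

primrec compile :: "lprog \<Rightarrow> com" where
  "compile LSkip = Skip"
| "compile (LWrite a e f) = Write a e f"
| "compile (LSeq c d) = Seq (compile c) (compile d)"
| "compile (LCond e c d) = Cond e (compile c) (compile d)"
| "compile (LFor v b c) =
    Seq (Write v (Const 0) (Const 0))
      (While (Sub (Read 0 (Const b)) (Read v (Const 0)))
        (Seq (compile c) (Write v (Const 0) (Add (Read v (Const 0)) (Const 1)))))"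

text \<open>Squaring a cell in a loop would make its length exponential in the number of iterations.
  Here a write exceeds the largest current cell by at most a constant; products occur only in tests
  and addresses.\<close>

fun storable :: "aexp \<Rightarrow> bool" where
  "storable (Const n) \<longleftrightarrow> True"
| "storable (Read a e) \<longleftrightarrow> True"
| "storable (Add e (Const n)) \<longleftrightarrow> storable e"
| "storable _ \<longleftrightarrow> False"

text \<open>Array 0 stays intact, so loop bounds are constant. \<open>b < 2\<close> restricts them
  to the numbers of facilities and clients, which are at most the input size, unlike the budget or a
  lower bound.\<close>

primrec wf_prog :: "lprog \<Rightarrow> bool" where
  "wf_prog LSkip \<longleftrightarrow> True"
| "wf_prog (LWrite a e f) \<longleftrightarrow> a \<noteq> 0 \<and> storable f"
| "wf_prog (LSeq c d) \<longleftrightarrow> wf_prog c \<and> wf_prog d"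
| "wf_prog (LCond e c d) \<longleftrightarrow> wf_prog c \<and> wf_prog d"
| "wf_prog (LFor v b c) \<longleftrightarrow> v \<noteq> 0 \<and> v \<notin> writes c \<and> b < 2 \<and> wf_prog c"

lemma upd_apply: "upd a i x s b j = (if b = a \<and> j = i then x else s b j)"
  by (simp add: upd_def)

lemma upd_other: "b \<noteq> a \<Longrightarrow> upd a i x s b = s b"
  by (simp add: upd_def)

lemma run_frame: "a \<notin> writes c \<Longrightarrow> run c s a = s a"
proof (induction c arbitrary: s)
  case (LFor v b c)
  have "fold (\<lambda>i s. run c (upd v 0 i s)) xs s a = s a" for xs s
    using LFor by (induction xs arbitrary: s) (auto simp: upd_other)
  then show ?case
    using LFor.prems by (simp add: upd_other)
qed (auto simp: upd_other)

lemma input_not_written: "wf_prog c \<Longrightarrow> 0 \<notin> writes c"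
  by (induction c) auto

lemma storable_bound:
  "storable e \<Longrightarrow> \<exists>k. \<forall>s M. (\<forall>a i. s a i \<le> M) \<longrightarrow> aval e s \<le> M + k"
proof (induction e rule: storable.induct)
  case (3 e n)
  then obtain k where "aval e s \<le> M + k" if "\<forall>a i. s a i \<le> M" for s M
    by auto
  then show ?case
    by (intro exI[of _ "k + n"]) (simp add: add_le_mono flip: add.assoc)
qed (auto intro: trans_le_add1 trans_le_add2)

text \<open>Induction on the number \<open>k\<close> of remaining iterations. The cell bound rises
  by \<open>G\<close> per iteration, so every iteration can be charged at the single point
  \<open>Z\<close>, which dominates the length of the cells at the end. The factor
  \<open>Suc k\<close> includes the last, failing test.\<close>

lemma compile_loop:
  assumes v: "v \<noteq> 0" "v \<notin> writes c" and wf: "wf_prog c"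
    and step: "\<And>s M. s 0 0 \<le> X \<Longrightarrow> s 0 1 \<le> X \<Longrightarrow> X \<le> M \<Longrightarrow> \<forall>a i. s a i \<le> M \<Longrightarrow>
        (\<forall>a i. run c s a i \<le> M + G) \<and>
        (\<exists>t \<le> poly q (X + len M). exec (compile c) s t (run c s))"
    and test: "\<And>s M. \<forall>a i. s a i \<le> M \<Longrightarrow> atime e s + len (aval e s) \<le> poly r (len M)"
    and incr: "\<And>s M. \<forall>a i. s a i \<le> M \<Longrightarrow> atime f s + len (aval f s) \<le> poly w (len M)"
    and e: "e = Sub (Read 0 (Const b)) (Read v (Const 0))"
    and f: "f = Add (Read v (Const 0)) (Const 1)"
    and Z: "X + len (M + k * G) \<le> Z"
    and bnd: "\<forall>a i. s a i \<le> M" "X \<le> M" "s 0 0 \<le> X" "s 0 1 \<le> X"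
    and k: "n = s 0 b" "n \<le> X" "s v 0 + k = n"
  shows "(\<forall>a i. upd v 0 n (fold (\<lambda>i s. run c (upd v 0 i s)) [s v 0..<n] s) a i \<le> M + k * G) \<and>
    (\<exists>t \<le> Suc k * (poly q Z + poly r Z + poly w Z + 4).
      exec (While e (Seq (compile c) (Write v (Const 0) f))) s t
        (upd v 0 n (fold (\<lambda>i s. run c (upd v 0 i s)) [s v 0..<n] s)))"
  using Z bnd k
proof (induction k arbitrary: s M)
  case 0
  have "atime e s + len (aval e s) \<le> poly r (len M)"
    by (rule test) (use 0 in auto)
  also have "\<dots> \<le> poly r Z"
    by (rule poly_nat_mono) (use 0 in auto)
  finally have t: "atime e s + len (aval e s) \<le> poly r Z" .
  have "upd v 0 (s v 0) s = s"
    by (simp add: upd_def)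
  then have "upd v 0 n s = s"
    using 0 by simp
  moreover have "exec (While e (Seq (compile c) (Write v (Const 0) f))) s (atime e s + len (aval e s)) s"
    by (rule WhileFalse) (use 0 in \<open>auto simp: e\<close>)
  ultimately show ?case
    using t 0 by (auto intro!: exI[of _ "atime e s + len (aval e s)"])
next
  case (Suc k)
  let ?d = "Seq (compile c) (Write v (Const 0) f)"
  define s1 where "s1 = run c s"
  define s2 where "s2 = upd v 0 (Suc (s v 0)) s1"
  let ?M = "M + G"
  have b1: "\<forall>a i. s1 a i \<le> ?M" and "\<exists>t \<le> poly q (X + len M). exec (compile c) s t s1"
    using step[of s M] Suc.prems by (auto simp: s1_def)
  then obtain t1 where t1: "t1 \<le> poly q (X + len M)" "exec (compile c) s t1 s1"
    by blast
  have v1: "s1 v = s v" and inp: "s1 0 = s 0"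
    using run_frame v input_not_written[OF wf] by (auto simp: s1_def)
  have inp2: "s2 0 = s 0"
    using v inp by (simp add: s2_def upd_other)
  \<comment> \<open>The incremented counter is at most \<open>n\<close>, hence at most
    \<open>X\<close> and \<open>M\<close>; the loop counter itself never raises the bound.\<close>
  have b2: "\<forall>a i. s2 a i \<le> ?M"
    using b1 Suc.prems by (auto simp: s2_def upd_apply)
  have eq: "upd v 0 n (fold (\<lambda>i s. run c (upd v 0 i s)) [s v 0..<n] s) =
      upd v 0 n (fold (\<lambda>i s. run c (upd v 0 i s)) [s2 v 0..<n] s2)"
  proof -
    have [simp]: "upd v 0 (s v 0) s = s"
      by (auto simp: upd_def)
    \<comment> \<open>Each iteration resets the counter first, and an empty fold is followed by the
      outer write, so the increment made by the compiled loop leaves no trace.\<close>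
    have absorb: "upd v 0 x (fold (\<lambda>i s. run c (upd v 0 i s)) xs (upd v 0 j u)) =
        upd v 0 x (fold (\<lambda>i s. run c (upd v 0 i s)) xs u)" for xs j u x
      by (cases xs) (simp_all add: upd_def)
    show ?thesis
      using Suc.prems by (simp add: upt_conv_Cons s2_def absorb upd_apply flip: s1_def)
  qed
  have Z2: "X + len (?M + k * G) \<le> Z"
    using Suc.prems by (simp add: algebra_simps)
  have "(\<forall>a i. upd v 0 n (fold (\<lambda>i s. run c (upd v 0 i s)) [s2 v 0..<n] s2) a i \<le> ?M + k * G) \<and>
    (\<exists>t \<le> Suc k * (poly q Z + poly r Z + poly w Z + 4).
      exec (While e ?d) s2 t (upd v 0 n (fold (\<lambda>i s. run c (upd v 0 i s)) [s2 v 0..<n] s2)))"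
    by (rule Suc.IH[OF Z2 b2]) (use Suc.prems in \<open>auto simp: inp2, auto simp: s2_def upd_apply\<close>)
  then obtain t2 where IH: "\<forall>a i. upd v 0 n (fold (\<lambda>i s. run c (upd v 0 i s)) [s2 v 0..<n] s2) a i \<le> ?M + k * G"
      "t2 \<le> Suc k * (poly q Z + poly r Z + poly w Z + 4)"
      "exec (While e ?d) s2 t2 (upd v 0 n (fold (\<lambda>i s. run c (upd v 0 i s)) [s2 v 0..<n] s2))"
    by blast
  have "exec (Write v (Const 0) f) s1 (atime (Const 0) s1 + atime f s1 + len (aval (Const 0) s1) + len (aval f s1))
     (s1(v := (s1 v)(aval (Const 0) s1 := aval f s1)))"
    by (rule Write)
  also have "s1(v := (s1 v)(aval (Const 0) s1 := aval f s1)) = s2"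
    by (simp add: s2_def upd_def f v1)
  finally have W: "exec (Write v (Const 0) f) s1
      (atime (Const 0) s1 + atime f s1 + len (aval (Const 0) s1) + len (aval f s1)) s2" .
  have ex: "exec (While e ?d) s (atime e s + len (aval e s) +
      (t1 + (atime (Const 0) s1 + atime f s1 + len (aval (Const 0) s1) + len (aval f s1))) + t2)
      (upd v 0 n (fold (\<lambda>i s. run c (upd v 0 i s)) [s v 0..<n] s))" (is "exec _ _ ?t _")
    unfolding eq by (rule WhileTrue[OF _ Seq[OF t1(2) W] IH(3)]) (use Suc.prems in \<open>auto simp: e\<close>)
  have lM: "X + len M \<le> Z" "len M \<le> Z" "len ?M \<le> Z"
    using Suc.prems(1) len_mono[of M "M + Suc k * G"] len_mono[of "M + G" "M + Suc k * G"] by auto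
  have "t1 \<le> poly q Z"
    using t1(1) poly_nat_mono[OF lM(1), of q] by linarith
  moreover have "atime e s + len (aval e s) \<le> poly r Z"
    using test[OF Suc.prems(2)] poly_nat_mono[OF lM(2), of r] by linarith
  moreover have "atime f s1 + len (aval f s1) \<le> poly w Z"
    using incr[OF b1] poly_nat_mono[OF lM(3), of w] by linarith
  moreover have "len 0 = 1"
    by (simp add: len_def floorlog_def)
  ultimately have "?t \<le> Suc (Suc k) * (poly q Z + poly r Z + poly w Z + 4)"
    using IH(2) by simp
  then show ?case
    using ex IH(1) unfolding eq by (auto simp: algebra_simps)
qed

text \<open>The growth \<open>g\<close> is a function of the loop bound \<open>X\<close> alone, not
  of the cell bound \<open>M\<close>. A loop then adds at most \<open>X * poly g X\<close> instead
  of iterating a polynomial, and \<open>M\<close> enters the time only through its length.\<close>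

lemma lprog_poly_time:
  "wf_prog c \<Longrightarrow> \<exists>g q :: nat poly. \<forall>s X M. s 0 0 \<le> X \<longrightarrow> s 0 1 \<le> X \<longrightarrow> X \<le> M \<longrightarrow> (\<forall>a i. s a i \<le> M) \<longrightarrow>
    (\<forall>a i. run c s a i \<le> M + poly g X) \<and>
    (\<exists>t \<le> poly q (X + len M). exec (compile c) s t (run c s))"
proof (induction c)
  case LSkip
  show ?case
    by (rule exI[of _ 0], rule exI[of _ "[:1:]"]) (auto intro!: exI[of _ 1] exec.Skip simp del: One_nat_def)
next
  case (LWrite a e f)
  obtain k where k: "aval f s \<le> M + k" if "\<forall>a i. s a i \<le> M" for s M
    using storable_bound[of f] LWrite by auto
  obtain p q :: "nat poly" where
    p: "atime e s + len (aval e s) \<le> poly p (len M)" and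
    q: "atime f s + len (aval f s) \<le> poly q (len M)" if "\<forall>a i. s a i \<le> M" for s M
    using aexp_poly_time by metis
  have "atime e s + atime f s + len (aval e s) + len (aval f s) \<le> poly (p + q) (X + len M)"
    if "\<forall>a i. s a i \<le> M" for s X M
    using p[OF that] q[OF that] poly_nat_mono[of "len M" "X + len M" p]
      poly_nat_mono[of "len M" "X + len M" q] by simp
  moreover have "\<forall>b i. run (LWrite a e f) s b i \<le> M + poly [:k:] X" if "\<forall>a i. s a i \<le> M" for s X M
    using k[OF that] that by (auto simp: upd_apply trans_le_add1)
  moreover have "exec (compile (LWrite a e f)) s
      (atime e s + atime f s + len (aval e s) + len (aval f s)) (run (LWrite a e f) s)" for s
    using exec.Write by (simp add: upd_def)
  ultimately show ?case
    by blast
next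
  case (LSeq c d)
  then obtain g1 q1 g2 q2 :: "nat poly" where
    c: "(\<forall>a i. run c s a i \<le> M + poly g1 X) \<and>
      (\<exists>t \<le> poly q1 (X + len M). exec (compile c) s t (run c s))" and
    d: "(\<forall>a i. run d s a i \<le> M + poly g2 X) \<and>
      (\<exists>t \<le> poly q2 (X + len M). exec (compile d) s t (run d s))"
    if "s 0 0 \<le> X" "s 0 1 \<le> X" "X \<le> M" "\<forall>a i. s a i \<le> M" for s X M
    by (simp only: wf_prog.simps) metis
  \<comment> \<open>The second program starts with cells up to \<open>M + poly g1 X\<close>. With
    \<open>Y = X + len M\<close>, their length plus \<open>X\<close> is at most
    \<open>1 + Y + poly g1 Y\<close>, which explains the composition.\<close>
  have "(\<forall>a i. run (LSeq c d) s a i \<le> M + poly (g1 + g2) X) \<and>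
      (\<exists>t \<le> poly (q1 + pcompose q2 ([:1, 1:] + g1)) (X + len M). exec (compile (LSeq c d)) s t (run (LSeq c d) s))"
    if b: "s 0 0 \<le> X" "s 0 1 \<le> X" "X \<le> M" "\<forall>a i. s a i \<le> M" for s X M
  proof -
    let ?Y = "X + len M"
    have "run c s 0 = s 0"
      using LSeq.prems by (simp add: run_frame input_not_written)
    with d[of "run c s" X "M + poly g1 X"] c[OF b] b
    have d': "(\<forall>a i. run d (run c s) a i \<le> M + poly g1 X + poly g2 X) \<and>
      (\<exists>t \<le> poly q2 (X + len (M + poly g1 X)). exec (compile d) (run c s) t (run d (run c s)))"
      by simp
    obtain t1 t2 where t: "t1 \<le> poly q1 ?Y" "exec (compile c) s t1 (run c s)"
      "t2 \<le> poly q2 (X + len (M + poly g1 X))" "exec (compile d) (run c s) t2 (run d (run c s))"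
      using c[OF b] d' by blast
    have "X + len (M + poly g1 X) \<le> poly ([:1, 1:] + g1) ?Y"
      using len_add_le[of M "poly g1 X"] poly_nat_mono[of X ?Y g1] by simp
    from poly_nat_mono[OF this, of q2] have "t1 + t2 \<le> poly (q1 + pcompose q2 ([:1, 1:] + g1)) ?Y"
      using t by (simp add: poly_pcompose)
    moreover have "exec (compile (LSeq c d)) s (t1 + t2) (run (LSeq c d) s)"
      using t by (auto intro: exec.Seq)
    ultimately show ?thesis
      using d' by (auto simp: add.assoc)
  qed
  then show ?case by blast
next
  case (LCond e c d)
  then obtain g1 q1 g2 q2 :: "nat poly" where
    c: "(\<forall>a i. run c s a i \<le> M + poly g1 X) \<and>
      (\<exists>t \<le> poly q1 (X + len M). exec (compile c) s t (run c s))" and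
    d: "(\<forall>a i. run d s a i \<le> M + poly g2 X) \<and>
      (\<exists>t \<le> poly q2 (X + len M). exec (compile d) s t (run d s))"
    if "s 0 0 \<le> X" "s 0 1 \<le> X" "X \<le> M" "\<forall>a i. s a i \<le> M" for s X M
    by (simp only: wf_prog.simps) metis
  obtain p :: "nat poly" where
    p: "atime e s + len (aval e s) \<le> poly p (len M)" if "\<forall>a i. s a i \<le> M" for s M
    using aexp_poly_time by metis
  have "(\<forall>a i. run (LCond e c d) s a i \<le> M + poly (g1 + g2) X) \<and>
      (\<exists>t \<le> poly (p + q1 + q2) (X + len M). exec (compile (LCond e c d)) s t (run (LCond e c d) s))"
    if b: "s 0 0 \<le> X" "s 0 1 \<le> X" "X \<le> M" "\<forall>a i. s a i \<le> M" for s X M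
  proof -
    let ?Y = "X + len M" and ?e = "atime e s + len (aval e s)"
    obtain t1 t2 where t: "t1 \<le> poly q1 ?Y" "exec (compile c) s t1 (run c s)"
      "t2 \<le> poly q2 ?Y" "exec (compile d) s t2 (run d s)"
      using c[OF b] d[OF b] by blast
    have "?e \<le> poly p ?Y"
      using p[OF b(4)] poly_nat_mono[of "len M" ?Y p] by simp
    then have "?e + t1 \<le> poly (p + q1 + q2) ?Y" "?e + t2 \<le> poly (p + q1 + q2) ?Y"
      using t by auto
    moreover have "exec (compile (LCond e c d)) s (?e + (if aval e s \<noteq> 0 then t1 else t2)) (run (LCond e c d) s)"
      using t IfTrue[of e s "compile c" t1] IfFalse[of e s "compile d" t2] by auto
    ultimately have "\<exists>t \<le> poly (p + q1 + q2) ?Y. exec (compile (LCond e c d)) s t (run (LCond e c d) s)"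
      by (metis (full_types))
    moreover have "run c s a i \<le> M + poly (g1 + g2) X" "run d s a i \<le> M + poly (g1 + g2) X" for a i
      using c[OF b, THEN conjunct1, THEN spec, THEN spec, of a i]
        d[OF b, THEN conjunct1, THEN spec, THEN spec, of a i] by simp_all
    then have "\<forall>a i. run (LCond e c d) s a i \<le> M + poly (g1 + g2) X"
      by simp
    ultimately show ?thesis by blast
  qed
  then show ?case by blast
next
  case (LFor v b c)
  then obtain g q :: "nat poly" where
    c: "(\<forall>a i. run c s a i \<le> M + poly g X) \<and>
      (\<exists>t \<le> poly q (X + len M). exec (compile c) s t (run c s))"
    if "s 0 0 \<le> X" "s 0 1 \<le> X" "X \<le> M" "\<forall>a i. s a i \<le> M" for s X M
    by (simp only: wf_prog.simps) metis
  define e where "e = Sub (Read 0 (Const b)) (Read v (Const 0))"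
  define f where "f = Add (Read v (Const 0)) (Const 1)"
  obtain r w :: "nat poly" where
    r: "atime e s + len (aval e s) \<le> poly r (len M)" and
    w: "atime f s + len (aval f s) \<le> poly w (len M)" if "\<forall>a i. s a i \<le> M" for s M
    using aexp_poly_time by metis
  \<comment> \<open>\<open>z\<close> bounds \<open>X\<close> plus the cell length after a whole
    loop, in which up to \<open>X * poly g X\<close> has been added. In \<open>h\<close>, the 4 is
    the exact cost of setting the counter to 0.\<close>
  define z :: "nat poly" where "z = [:1, 1:] + [:0, 1:] * g"
  define h :: "nat poly" where "h = [:4:] + [:1, 1:] * pcompose (q + r + w + [:4:]) z"
  have "(\<forall>a i. run (LFor v b c) s a i \<le> M + poly ([:0, 1:] * g) X) \<and>
      (\<exists>t \<le> poly h (X + len M). exec (compile (LFor v b c)) s t (run (LFor v b c) s))"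
    if bd: "s 0 0 \<le> X" "s 0 1 \<le> X" "X \<le> M" "\<forall>a i. s a i \<le> M" for s X M
  proof -
    let ?Y = "X + len M" and ?k = "s 0 b"
    define s0 where "s0 = upd v 0 0 s"
    define Z where "Z = poly z ?Y"
    have [simp]: "s0 0 = s 0" "s0 v 0 = 0"
      using LFor.prems by (auto simp: s0_def upd_apply upd_other)
    have k: "?k \<le> X"
      using bd LFor.prems by (auto simp: less_2_cases_iff)
    have Z: "X + len (M + ?k * poly g X) \<le> Z"
    proof -
      have "?k * poly g X \<le> ?Y * poly g ?Y"
        using k by (intro mult_le_mono poly_nat_mono) auto
      then show ?thesis
        using len_add_le[of M "?k * poly g X"] by (simp add: Z_def z_def)
    qed
    have step: "(\<forall>a i. run c s a i \<le> M + poly g X) \<and>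
        (\<exists>t \<le> poly q (X + len M). exec (compile c) s t (run c s))"
      if "s 0 0 \<le> X" "s 0 1 \<le> X" "X \<le> M" "\<forall>a i. s a i \<le> M" for s M
      using c that by blast
    have loop: "(\<forall>a i. upd v 0 ?k (fold (\<lambda>i s. run c (upd v 0 i s)) [s0 v 0..<?k] s0) a i \<le> M + ?k * poly g X) \<and>
      (\<exists>t \<le> Suc ?k * (poly q Z + poly r Z + poly w Z + 4).
      exec (While e (Seq (compile c) (Write v (Const 0) f))) s0 t
        (upd v 0 ?k (fold (\<lambda>i s. run c (upd v 0 i s)) [s0 v 0..<?k] s0)))"
      by (rule compile_loop[OF _ _ _ step r w e_def f_def Z])
        (use LFor.prems bd k in \<open>auto simp: s0_def upd_apply\<close>)
    moreover have "run (LFor v b c) s = upd v 0 ?k (fold (\<lambda>i s. run c (upd v 0 i s)) [s0 v 0..<?k] s0)"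
    proof -
      have "upd v 0 x (fold (\<lambda>i s. run c (upd v 0 i s)) xs (upd v 0 j u)) =
          upd v 0 x (fold (\<lambda>i s. run c (upd v 0 i s)) xs u)" for xs x j u
        by (cases xs) (simp_all add: upd_def)
      then show ?thesis
        by (simp add: s0_def upd_apply)
    qed
    ultimately obtain t where
      bnd: "\<forall>a i. run (LFor v b c) s a i \<le> M + ?k * poly g X" and
      t: "t \<le> Suc ?k * (poly q Z + poly r Z + poly w Z + 4)"
        "exec (While e (Seq (compile c) (Write v (Const 0) f))) s0 t (run (LFor v b c) s)"
      by auto
    have "exec (Write v (Const 0) (Const 0)) s 4 s0"
      using Write[of v "Const 0" "Const 0" s] by (simp add: s0_def upd_def len_def floorlog_def eval_nat_numeral)
    from Seq[OF this t(2)] have "exec (compile (LFor v b c)) s (4 + t) (run (LFor v b c) s)"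
      by (simp add: e_def f_def)
    moreover have "4 + t \<le> poly h ?Y"
    proof -
      have "t \<le> Suc ?Y * (poly q Z + poly r Z + poly w Z + 4)"
        using k by (intro order_trans[OF t(1)] mult_le_mono) auto
      then show ?thesis
        by (simp add: h_def poly_pcompose Z_def)
    qed
    moreover have "run (LFor v b c) s a i \<le> M + poly ([:0, 1:] * g) X" for a i
    proof -
      have "M + ?k * poly g X \<le> M + X * poly g X"
        using k by (intro add_left_mono mult_le_mono1)
      also have "X * poly g X = poly ([:0, 1:] * g) X"
        by simp
      finally show ?thesis
        by (rule order_trans[OF bnd[rule_format]])
    qed
    ultimately show ?thesis by blast
  qed
  then show ?case by blast
qed

section \<open>The greedy packing\<close>

definition nbhd :: "lbkso \<Rightarrow> rat \<Rightarrow> nat \<Rightarrow> nat set" where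
  "nbhd I \<tau> i = {j. j < ncli I \<and> dst I (Fac i) (Cli j) \<le> \<tau>}"

definition addable :: "lbkso \<Rightarrow> rat \<Rightarrow> nat set \<Rightarrow> nat set" where
  "addable I \<tau> F = {i. i < nfac I \<and> lower I i \<le> card (nbhd I \<tau> i) \<and>
     (\<forall>i'\<in>F. 4 * \<tau> < dst I (Fac i) (Fac i'))}"

text \<open>A relation, so that breaking ties is left to the program.\<close>

definition greedy_step :: "lbkso \<Rightarrow> rat \<Rightarrow> nat set \<Rightarrow> nat set \<Rightarrow> bool" where
  "greedy_step I \<tau> F F' \<longleftrightarrow>
     (if addable I \<tau> F = {} \<or> budget I \<le> card F then F' = F
      else \<exists>i\<in>addable I \<tau> F. (\<forall>i'\<in>addable I \<tau> F. card (nbhd I \<tau> i') \<le> card (nbhd I \<tau> i)) \<and>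
             F' = insert i F)"

definition uncovered :: "lbkso \<Rightarrow> rat \<Rightarrow> nat set \<Rightarrow> nat set" where
  "uncovered I \<tau> F = {j. j < ncli I \<and> (\<forall>i\<in>F. 5 * \<tau> < dst I (Fac i) (Cli j))}"

definition packing :: "lbkso \<Rightarrow> rat \<Rightarrow> nat set \<Rightarrow> bool" where
  "packing I \<tau> F \<longleftrightarrow> F \<subseteq> {..<nfac I} \<and> card F \<le> budget I \<and>
     (\<forall>i\<in>F. lower I i \<le> card (nbhd I \<tau> i)) \<and>
     (\<forall>i\<in>F. \<forall>i'\<in>F. i \<noteq> i' \<longrightarrow> 4 * \<tau> < dst I (Fac i) (Fac i'))"

definition witness :: "lbkso \<Rightarrow> rat \<Rightarrow> nat set \<Rightarrow> nat set \<Rightarrow> (nat \<rightharpoonup> nat) \<Rightarrow> bool" where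
  "witness I \<tau> F S \<sigma> \<longleftrightarrow> feasible I S \<sigma> \<and> cost I S \<sigma> \<le> \<tau> \<and>
     (\<forall>i\<in>F. \<exists>i'\<in>S. dst I (Fac i) (Fac i') \<le> 2 * \<tau>)"

definition solvable :: "lbkso \<Rightarrow> rat \<Rightarrow> bool" where
  "solvable I \<tau> \<longleftrightarrow> (\<exists>S \<sigma>. feasible I S \<sigma> \<and> cost I S \<sigma> \<le> \<tau>)"

text \<open>\<open>r\<close> counts rounds: after \<open>nfac I\<close> of them either all
  facilities are chosen or no step is possible. The last conjunct is a disjunction because the
  exchange needs an open facility far from \<open>F\<close>, guaranteed only while too many clients
  are uncovered; once few enough are, this persists as \<open>F\<close> grows.\<close>

definition greedy_inv :: "lbkso \<Rightarrow> rat \<Rightarrow> nat \<Rightarrow> nat set \<Rightarrow> bool" where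
  "greedy_inv I \<tau> r F \<longleftrightarrow> packing I \<tau> F \<and>
     (r \<le> card F \<or> addable I \<tau> F = {} \<or> budget I \<le> card F) \<and>
     (solvable I \<tau> \<longrightarrow> (\<exists>S \<sigma>. witness I \<tau> F S \<sigma>) \<or> card (uncovered I \<tau> F) \<le> outliers I)"

lemma valid_refl: "valid I \<Longrightarrow> x \<in> points I \<Longrightarrow> dst I x x = 0"
  by (simp add: valid_def)

lemma valid_sym: "valid I \<Longrightarrow> x \<in> points I \<Longrightarrow> y \<in> points I \<Longrightarrow> dst I x y = dst I y x"
  by (simp add: valid_def)

lemma valid_nonneg: "valid I \<Longrightarrow> x \<in> points I \<Longrightarrow> y \<in> points I \<Longrightarrow> 0 \<le> dst I x y"
  by (simp add: valid_def)

lemma valid_triangle: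
  "valid I \<Longrightarrow> x \<in> points I \<Longrightarrow> y \<in> points I \<Longrightarrow> z \<in> points I \<Longrightarrow> dst I x z \<le> dst I x y + dst I y z"
  by (simp add: valid_def)

lemma points_simps [simp]:
  "Fac i \<in> points I \<longleftrightarrow> i < nfac I" "Cli j \<in> points I \<longleftrightarrow> j < ncli I"
  by (auto simp: points_def)

lemma finite_nbhd [simp]: "finite (nbhd I \<tau> i)"
  by (simp add: nbhd_def)

lemma finite_uncovered [simp]: "finite (uncovered I \<tau> F)"
  by (simp add: uncovered_def)

lemma packing_finite: "packing I \<tau> F \<Longrightarrow> finite F"
  by (auto simp: packing_def intro: finite_subset)

lemma feasible_finite: "feasible I S \<sigma> \<Longrightarrow> finite S"
  by (auto simp: feasible_def intro: finite_subset)

lemma finite_service: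
  assumes "feasible I S \<sigma>"
  shows "finite {dst I (Fac i) (Cli j) | i j. i \<in> S \<and> j < ncli I \<and> \<sigma> j = Some i}"
proof (rule finite_subset)
  show "{dst I (Fac i) (Cli j) | i j. i \<in> S \<and> j < ncli I \<and> \<sigma> j = Some i}
    \<subseteq> (\<lambda>(i, j). dst I (Fac i) (Cli j)) ` (S \<times> {..<ncli I})"
    by auto
qed (use feasible_finite[OF assms] in auto)

lemma cost_le_iff:
  assumes "feasible I S \<sigma>"
  shows "cost I S \<sigma> \<le> \<tau> \<longleftrightarrow> 0 \<le> \<tau> \<and> (\<forall>i j. \<sigma> j = Some i \<longrightarrow> dst I (Fac i) (Cli j) \<le> \<tau>)"
proof -
  have "i \<in> S \<and> j < ncli I" if "\<sigma> j = Some i" for i j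
    using assms that by (auto simp: feasible_def ran_def)
  then show ?thesis
    unfolding cost_def using finite_service[OF assms] by (subst Max_le_iff) (simp, simp, blast)
qed

lemma cost_le_nonneg: "feasible I S \<sigma> \<Longrightarrow> cost I S \<sigma> \<le> \<tau> \<Longrightarrow> 0 \<le> \<tau>"
  by (simp add: cost_le_iff)

lemma served_within:
  "feasible I S \<sigma> \<Longrightarrow> cost I S \<sigma> \<le> \<tau> \<Longrightarrow> \<sigma> j = Some i \<Longrightarrow> dst I (Fac i) (Cli j) \<le> \<tau>"
  by (simp add: cost_le_iff)

lemma feasible_served:
  assumes "feasible I S \<sigma>" "\<sigma> j = Some i"
  shows "i \<in> S" "i < nfac I" "j < ncli I"
  using assms by (auto simp: feasible_def ran_def)

text \<open>Makes open facilities of a cheap solution eligible for the greedy choice: the clients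
  they serve lie in their neighbourhoods.\<close>

lemma lower_le_nbhd:
  assumes "feasible I S \<sigma>" "cost I S \<sigma> \<le> \<tau>" "i \<in> S"
  shows "lower I i \<le> card (nbhd I \<tau> i)"
proof -
  have "lower I i \<le> card {j. j < ncli I \<and> \<sigma> j = Some i}"
    using assms by (simp add: feasible_def)
  also have "\<dots> \<le> card (nbhd I \<tau> i)"
  proof (rule card_mono)
    show "{j. j < ncli I \<and> \<sigma> j = Some i} \<subseteq> nbhd I \<tau> i"
      using served_within[OF assms(1,2)] unfolding nbhd_def by blast
  qed simp
  finally show ?thesis .
qed

text \<open>Lets the exchange argument compare numbers of served clients instead of numbers of
  outliers.\<close>

lemma outlier_bound_iff:
  assumes "dom \<sigma> \<subseteq> {..<n}"
  shows "card {j. j < n \<and> \<sigma> j = None} \<le> m \<longleftrightarrow> n \<le> m + card (dom \<sigma>)"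
proof -
  have "{j. j < n \<and> \<sigma> j = None} = {..<n} - dom \<sigma>"
    by auto
  moreover have "card ({..<n} - dom \<sigma>) = n - card (dom \<sigma>)"
    using card_Diff_subset[OF finite_subset[OF assms finite_lessThan] assms] by simp
  ultimately have "card {j. j < n \<and> \<sigma> j = None} = n - card (dom \<sigma>)"
    by (rule trans[OF arg_cong])
  then show ?thesis
    by linarith
qed

text \<open>A client served by i' is within 4\<tau> + \<tau> of \<open>F\<close>, so only outliers
  of \<sigma> remain uncovered. Also used contrapositively: too many uncovered clients yield an open
  facility beyond 4\<tau> from all of \<open>F\<close>.\<close>

lemma covered_if_close:
  assumes val: "valid I" and feas: "feasible I S \<sigma>" "cost I S \<sigma> \<le> \<tau>" and F: "F \<subseteq> {..<nfac I}"
    and close: "\<forall>i'\<in>S. \<exists>i\<in>F. dst I (Fac i) (Fac i') \<le> 4 * \<tau>"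
  shows "card (uncovered I \<tau> F) \<le> outliers I"
proof -
  have "uncovered I \<tau> F \<subseteq> {j. j < ncli I \<and> \<sigma> j = None}"
  proof (rule subsetI, rule ccontr)
    fix j assume j: "j \<in> uncovered I \<tau> F" "j \<notin> {j. j < ncli I \<and> \<sigma> j = None}"
    then obtain i' where i': "\<sigma> j = Some i'"
      by (auto simp: uncovered_def)
    note s = feasible_served[OF feas(1) i']
    obtain i where i: "i \<in> F" "dst I (Fac i) (Fac i') \<le> 4 * \<tau>"
      using close s by blast
    have "dst I (Fac i) (Cli j) \<le> dst I (Fac i) (Fac i') + dst I (Fac i') (Cli j)"
      by (rule valid_triangle) (use val i F s in auto)
    also have "\<dots> \<le> 4 * \<tau> + \<tau>"
      using i served_within[OF feas i'] by (intro add_mono) auto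
    finally show False
      using j(1) i(1) by (auto simp: uncovered_def)
  qed
  then have "card (uncovered I \<tau> F) \<le> card {j. j < ncli I \<and> \<sigma> j = None}"
    by (intro card_mono) auto
  also have "\<dots> \<le> outliers I"
    using feas by (simp add: feasible_def)
  finally show ?thesis .
qed

text \<open>
  Separation makes the map from \<open>F\<close> to nearby facilities of the witness injective, so a packing of
  full size meets the vicinity of every facility of the witness.
\<close>

lemma covered_if_full:
  assumes val: "valid I" and pack: "packing I \<tau> F" and wit: "witness I \<tau> F S \<sigma>"
    and full: "budget I \<le> card F"
  shows "card (uncovered I \<tau> F) \<le> outliers I"
proof -
  have feas: "feasible I S \<sigma>" "cost I S \<sigma> \<le> \<tau>" and S: "S \<subseteq> {..<nfac I}" "card S \<le> budget I"
    using wit by (auto simp: witness_def feasible_def)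
  have F: "F \<subseteq> {..<nfac I}"
    using pack by (simp add: packing_def)
  obtain f where f: "f i \<in> S" "dst I (Fac i) (Fac (f i)) \<le> 2 * \<tau>" if "i \<in> F" for i
    using wit unfolding witness_def by metis
  have inj: "inj_on f F"
  proof (rule inj_onI, rule ccontr)
    fix x y assume xy: "x \<in> F" "y \<in> F" "f x = f y" "x \<noteq> y"
    have "dst I (Fac x) (Fac y) \<le> dst I (Fac x) (Fac (f x)) + dst I (Fac (f x)) (Fac y)"
      by (rule valid_triangle) (use val xy f F S in auto)
    also have "dst I (Fac (f x)) (Fac y) = dst I (Fac y) (Fac (f y))"
      unfolding xy(3) by (rule valid_sym) (use val xy f F S in auto)
    also have "dst I (Fac x) (Fac (f x)) + \<dots> \<le> 2 * \<tau> + 2 * \<tau>"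
      using f(2)[OF xy(1)] f(2)[OF xy(2)] by (rule add_mono)
    finally show False
      using pack xy by (force simp: packing_def)
  qed
  \<comment> \<open>\<open>f\<close> embeds \<open>F\<close> into \<open>S\<close>, and
    \<open>card S \<le> budget I \<le> card F\<close> makes it onto.\<close>
  have "f ` F = S"
    using f(1) S full card_image[OF inj] by (intro card_seteq[OF feasible_finite[OF feas(1)]]) auto
  have "0 \<le> \<tau>"
    by (rule cost_le_nonneg[OF feas])
  have "\<forall>i'\<in>S. \<exists>i\<in>F. dst I (Fac i) (Fac i') \<le> 4 * \<tau>"
  proof
    fix i' assume "i' \<in> S"
    then obtain i where "i \<in> F" "f i = i'"
      using \<open>f ` F = S\<close> by auto
    then show "\<exists>i\<in>F. dst I (Fac i) (Fac i') \<le> 4 * \<tau>"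
      using f[of i] \<open>0 \<le> \<tau>\<close> by (intro bexI[of _ i]) auto
  qed
  then show ?thesis
    by (rule covered_if_close[OF val feas F])
qed

text \<open>
  If no facility of the solution is near \<open>i\<close>, then all clients around \<open>i\<close> are outliers, and a facility
  \<open>i\<^sub>0\<close> serving at most as many clients can be exchanged for \<open>i\<close>.
\<close>

lemma swap_feasible:
  assumes val: "valid I" and feas: "feasible I S \<sigma>" "cost I S \<sigma> \<le> \<tau>"
    and i: "i < nfac I" "lower I i \<le> card (nbhd I \<tau> i)"
    and far: "\<forall>i'\<in>S. 2 * \<tau> < dst I (Fac i) (Fac i')"
    and i0: "i0 \<in> S" "card (nbhd I \<tau> i0) \<le> card (nbhd I \<tau> i)"
  shows "\<exists>\<sigma>'. feasible I (insert i (S - {i0})) \<sigma>' \<and> cost I (insert i (S - {i0})) \<sigma>' \<le> \<tau>"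
proof -
  define \<sigma>' where "\<sigma>' j = (if j \<in> nbhd I \<tau> i then Some i else if \<sigma> j = Some i0 then None else \<sigma> j)" for j
  note serve = served_within[OF feas]
  have \<tau>: "0 \<le> \<tau>"
    by (rule cost_le_nonneg[OF feas])
  have S: "S \<subseteq> {..<nfac I}" "card S \<le> budget I" and dom: "dom \<sigma> \<subseteq> {..<ncli I}"
    using feas by (auto simp: feasible_def)
  have "i \<notin> S"
    using far \<tau> valid_refl[OF val, of "Fac i"] i by force
  \<comment> \<open>A server of such a client would be within \<tau> + \<tau> of \<open>i\<close>,
    against \<open>far\<close>. Hence \<sigma>' takes no client away from facilities other than
    \<open>i0\<close>.\<close>
  have out: "\<sigma> j = None" if "j \<in> nbhd I \<tau> i" for j
  proof (rule ccontr)
    assume "\<sigma> j \<noteq> None"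
    then obtain i' where i': "\<sigma> j = Some i'" by auto
    note s = feasible_served[OF feas(1) i']
    have "dst I (Fac i) (Fac i') \<le> dst I (Fac i) (Cli j) + dst I (Cli j) (Fac i')"
      by (rule valid_triangle) (use val i s in auto)
    also have "dst I (Cli j) (Fac i') = dst I (Fac i') (Cli j)"
      by (rule valid_sym) (use val s in auto)
    also have "dst I (Fac i) (Cli j) + \<dots> \<le> \<tau> + \<tau>"
      using that serve[OF i'] by (intro add_mono) (auto simp: nbhd_def)
    finally show False
      using far s by auto
  qed
  have dom': "dom \<sigma>' = nbhd I \<tau> i \<union> (dom \<sigma> - {j. \<sigma> j = Some i0})"
    by (auto simp: \<sigma>'_def dom_def)
  have fin: "finite (dom \<sigma>)"
    using dom by (rule finite_subset) simp
  \<comment> \<open>At most \<open>card (nbhd I \<tau> i0)\<close> clients are lost, and exactly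
    \<open>card (nbhd I \<tau> i)\<close> previously unserved ones are gained.\<close>
  have "card (dom \<sigma>) \<le> card (dom \<sigma>')"
  proof -
    have "card (dom \<sigma>) \<le> card (dom \<sigma> - {j. \<sigma> j = Some i0}) + card {j. \<sigma> j = Some i0}"
    proof -
      have "{j. \<sigma> j = Some i0} \<subseteq> dom \<sigma>" by auto
      then show ?thesis
        using fin card_Diff_subset[of "{j. \<sigma> j = Some i0}" "dom \<sigma>"] card_mono[OF fin] finite_subset[OF _ fin]
        by simp
    qed
    also have "card {j. \<sigma> j = Some i0} \<le> card (nbhd I \<tau> i0)"
      using serve feasible_served[OF feas(1)] by (intro card_mono) (auto simp: nbhd_def)
    also have "\<dots> \<le> card (nbhd I \<tau> i)"
      by (rule i0)
    also have "card (dom \<sigma> - {j. \<sigma> j = Some i0}) + \<dots> = card (dom \<sigma>')"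
      unfolding dom' using fin out by (subst card_Un_disjoint) auto
    finally show ?thesis by simp
  qed
  moreover have dom_sub: "dom \<sigma>' \<subseteq> {..<ncli I}"
    unfolding dom' using dom by (auto simp: nbhd_def)
  ultimately have "card {j. j < ncli I \<and> \<sigma>' j = None} \<le> outliers I"
    using feas dom outlier_bound_iff[OF dom, of "outliers I"] outlier_bound_iff[OF dom_sub, of "outliers I"]
    by (auto simp: feasible_def)
  moreover have "card (insert i (S - {i0})) \<le> budget I"
    using S i0 feasible_finite[OF feas(1)] \<open>i \<notin> S\<close> card_Suc_Diff1[of S i0] by simp
  moreover have "lower I x \<le> card {j. j < ncli I \<and> \<sigma>' j = Some x}" if "x \<in> insert i (S - {i0})" for x
  proof (cases "x = i")
    case True
    have "{j. j < ncli I \<and> \<sigma>' j = Some i} = nbhd I \<tau> i"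
      using \<open>i \<notin> S\<close> feasible_served[OF feas(1)] by (auto simp: \<sigma>'_def nbhd_def)
    then show ?thesis
      using i True by simp
  next
    case False
    then have "{j. j < ncli I \<and> \<sigma>' j = Some x} = {j. j < ncli I \<and> \<sigma> j = Some x}"
      using that out by (auto simp: \<sigma>'_def)
    then show ?thesis
      using feas that False by (auto simp: feasible_def)
  qed
  moreover have "ran \<sigma>' \<subseteq> insert i (S - {i0})"
    using feasible_served[OF feas(1)] by (auto simp: ran_def \<sigma>'_def split: if_splits)
  ultimately have feas': "feasible I (insert i (S - {i0})) \<sigma>'"
    using dom_sub S i by (auto simp: feasible_def)
  moreover have "cost I (insert i (S - {i0})) \<sigma>' \<le> \<tau>"
    unfolding cost_le_iff[OF feas'] using \<tau> serve by (auto simp: \<sigma>'_def nbhd_def split: if_splits)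
  ultimately show ?thesis by blast
qed

text \<open>Either the witness already has an open facility within 2\<tau> of \<open>i\<close>, or
  \<open>i\<close> becomes its own partner by replacing an open facility \<open>i0\<close> that is
  far from \<open>F\<close>; \<open>unc\<close> supplies \<open>i0\<close>.\<close>

lemma witness_extend:
  assumes val: "valid I" and pack: "packing I \<tau> F" and wit: "witness I \<tau> F S \<sigma>"
    and i: "i \<in> addable I \<tau> F" "\<forall>i'\<in>addable I \<tau> F. card (nbhd I \<tau> i') \<le> card (nbhd I \<tau> i)"
    and unc: "\<not> card (uncovered I \<tau> F) \<le> outliers I"
  shows "\<exists>S \<sigma>. witness I \<tau> (insert i F) S \<sigma>"
proof (cases "\<exists>i'\<in>S. dst I (Fac i) (Fac i') \<le> 2 * \<tau>")
  case True
  then have "witness I \<tau> (insert i F) S \<sigma>"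
    using wit by (auto simp: witness_def)
  then show ?thesis by blast
next
  case False
  have feas: "feasible I S \<sigma>" "cost I S \<sigma> \<le> \<tau>" and S: "S \<subseteq> {..<nfac I}"
    using wit by (auto simp: witness_def feasible_def)
  have F: "F \<subseteq> {..<nfac I}"
    using pack by (simp add: packing_def)
  have \<tau>: "0 \<le> \<tau>"
    by (rule cost_le_nonneg[OF feas])
  obtain i0 where i0: "i0 \<in> S" "\<forall>x\<in>F. 4 * \<tau> < dst I (Fac x) (Fac i0)"
    using covered_if_close[OF val feas F] unc by force
  \<comment> \<open>Being a candidate itself, \<open>i0\<close> has a neighbourhood no larger than
    that of the greedy choice \<open>i\<close>.\<close>
  have "i0 \<in> addable I \<tau> F"
    using i0 S F lower_le_nbhd[OF feas i0(1)] valid_sym[OF val, of "Fac i0"]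
    by (auto simp: addable_def subset_eq)
  then have "\<exists>\<sigma>'. feasible I (insert i (S - {i0})) \<sigma>' \<and> cost I (insert i (S - {i0})) \<sigma>' \<le> \<tau>"
    using i False i0 by (intro swap_feasible[OF val feas]) (auto simp: addable_def not_le)
  then obtain \<sigma>' where \<sigma>': "feasible I (insert i (S - {i0})) \<sigma>'" "cost I (insert i (S - {i0})) \<sigma>' \<le> \<tau>"
    by blast
  have "\<exists>i'\<in>insert i (S - {i0}). dst I (Fac x) (Fac i') \<le> 2 * \<tau>" if "x \<in> insert i F" for x
  proof (cases "x = i")
    case True
    then show ?thesis
      using valid_refl[OF val, of "Fac i"] i(1) \<tau> by (auto simp: addable_def)
  next
    case False
    then obtain i' where i': "i' \<in> S" "dst I (Fac x) (Fac i') \<le> 2 * \<tau>"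
      using wit \<open>x \<in> insert i F\<close> by (auto simp: witness_def)
    \<comment> \<open>The partner of \<open>x\<close> is within 2\<tau>, while \<open>i0\<close> is
      beyond 4\<tau>, so deleting \<open>i0\<close> leaves every partner in place.\<close>
    then have "i' \<noteq> i0"
      using i0(2) \<tau> \<open>x \<in> insert i F\<close> False by force
    then show ?thesis
      using i' by auto
  qed
  then show ?thesis
    using \<sigma>' unfolding witness_def by blast
qed

lemma uncovered_antimono: "F \<subseteq> F' \<Longrightarrow> card (uncovered I \<tau> F') \<le> card (uncovered I \<tau> F)"
  by (rule card_mono) (simp, unfold uncovered_def, blast)

lemma greedy_inv_init: "greedy_inv I \<tau> 0 {}"
  by (simp add: greedy_inv_def packing_def witness_def solvable_def)

lemma greedy_inv_step:
  assumes val: "valid I" and \<tau>: "0 \<le> \<tau>" and inv: "greedy_inv I \<tau> r F" and step: "greedy_step I \<tau> F F'"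
  shows "greedy_inv I \<tau> (Suc r) F'"
proof (cases "addable I \<tau> F = {} \<or> budget I \<le> card F")
  case True
  then show ?thesis
    using inv step by (auto simp: greedy_inv_def greedy_step_def)
next
  case False
  then obtain i where i: "i \<in> addable I \<tau> F" "\<forall>i'\<in>addable I \<tau> F. card (nbhd I \<tau> i') \<le> card (nbhd I \<tau> i)"
    and F': "F' = insert i F"
    using step by (auto simp: greedy_step_def)
  have pack: "packing I \<tau> F"
    using inv by (simp add: greedy_inv_def)
  have far: "4 * \<tau> < dst I (Fac i) (Fac i')" "4 * \<tau> < dst I (Fac i') (Fac i)" if "i' \<in> F" for i'
    using i(1) that pack valid_sym[OF val, of "Fac i" "Fac i'"]
    by (auto simp: addable_def packing_def subset_eq)
  have "i \<notin> F"
    using far(1)[of i] valid_refl[OF val, of "Fac i"] i(1) \<tau> by (auto simp: addable_def)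
  then have card: "card F' = Suc (card F)"
    using packing_finite[OF pack] by (simp add: F')
  have "packing I \<tau> F'"
    using pack i(1) far False card by (auto simp: packing_def F' addable_def)
  moreover have "Suc r \<le> card F' \<or> addable I \<tau> F' = {} \<or> budget I \<le> card F'"
    using inv False card by (auto simp: greedy_inv_def)
  moreover have "(\<exists>S \<sigma>. witness I \<tau> F' S \<sigma>) \<or> card (uncovered I \<tau> F') \<le> outliers I" if "solvable I \<tau>"
    using that inv witness_extend[OF val pack _ i] uncovered_antimono[of F F' I \<tau>]
    unfolding greedy_inv_def F' by (meson le_trans subset_insertI)
  ultimately show ?thesis
    by (simp add: greedy_inv_def)
qed

text \<open>Otherwise some open facility \<open>i0\<close> is still addable, and the packing has not
  reached the budget by \<open>covered_if_full\<close>. So the rounds must have chosen every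
  facility, including \<open>i0\<close>, which is at distance 0 from itself.\<close>

lemma greedy_inv_final:
  assumes val: "valid I" and \<tau>: "0 \<le> \<tau>" and inv: "greedy_inv I \<tau> (nfac I) F" and "solvable I \<tau>"
  shows "card (uncovered I \<tau> F) \<le> outliers I"
proof (rule ccontr)
  assume unc: "\<not> card (uncovered I \<tau> F) \<le> outliers I"
  have pack: "packing I \<tau> F"
    using inv by (simp add: greedy_inv_def)
  then have F: "F \<subseteq> {..<nfac I}"
    by (simp add: packing_def)
  obtain S \<sigma> where wit: "witness I \<tau> F S \<sigma>"
    using inv unc assms by (auto simp: greedy_inv_def)
  then have feas: "feasible I S \<sigma>" "cost I S \<sigma> \<le> \<tau>" and S: "S \<subseteq> {..<nfac I}"
    by (auto simp: witness_def feasible_def)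
  obtain i0 where i0: "i0 \<in> S" "\<forall>x\<in>F. 4 * \<tau> < dst I (Fac x) (Fac i0)"
    using covered_if_close[OF val feas F] unc by force
  have "i0 \<in> addable I \<tau> F"
    using i0 S F lower_le_nbhd[OF feas i0(1)] valid_sym[OF val, of "Fac i0"]
    by (auto simp: addable_def subset_eq)
  then have "nfac I \<le> card F"
    using inv covered_if_full[OF val pack wit] unc by (auto simp: greedy_inv_def)
  then have "F = {..<nfac I}"
    using F card_subset_eq[of "{..<nfac I}" F] card_mono[of "{..<nfac I}" F] by simp
  then show False
    using i0 S valid_refl[OF val, of "Fac i0"] \<tau> by force
qed

text \<open>Clients in a neighbourhood are bound to its facility, which secures the lower bounds;
  other covered clients may go to any chosen facility within 5\<tau>. These demands are compatible
  because neighbourhoods in a packing are disjoint.\<close>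

definition assigned :: "lbkso \<Rightarrow> rat \<Rightarrow> nat set \<Rightarrow> (nat \<rightharpoonup> nat) \<Rightarrow> bool" where
  "assigned I \<tau> F \<sigma> \<longleftrightarrow> dom \<sigma> = {..<ncli I} - uncovered I \<tau> F \<and>
     (\<forall>i j. \<sigma> j = Some i \<longrightarrow> i \<in> F \<and> dst I (Fac i) (Cli j) \<le> 5 * \<tau>) \<and>
     (\<forall>i\<in>F. \<forall>j\<in>nbhd I \<tau> i. \<sigma> j = Some i)"

lemma assigned_solution:
  assumes val: "valid I" and \<tau>: "0 \<le> \<tau>" and pack: "packing I \<tau> F"
    and unc: "card (uncovered I \<tau> F) \<le> outliers I" and asg: "assigned I \<tau> F \<sigma>"
  shows "feasible I F \<sigma>" "cost I F \<sigma> \<le> 5 * \<tau>"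
proof -
  have near: "i \<in> F \<and> dst I (Fac i) (Cli j) \<le> 5 * \<tau>" if "\<sigma> j = Some i" for i j
    using that asg unfolding assigned_def by blast
  have own: "\<forall>i\<in>F. \<forall>j\<in>nbhd I \<tau> i. \<sigma> j = Some i"
    using asg unfolding assigned_def by blast
  have dom: "dom \<sigma> = {..<ncli I} - uncovered I \<tau> F"
    using asg unfolding assigned_def by blast
  have ran: "ran \<sigma> \<subseteq> F"
    using near unfolding ran_def by blast
  have "lower I i \<le> card {j. j < ncli I \<and> \<sigma> j = Some i}" if "i \<in> F" for i
  proof -
    have "lower I i \<le> card (nbhd I \<tau> i)"
      using pack that by (simp add: packing_def)
    also have "\<dots> \<le> card {j. j < ncli I \<and> \<sigma> j = Some i}"
    proof (rule card_mono)
      show "nbhd I \<tau> i \<subseteq> {j. j < ncli I \<and> \<sigma> j = Some i}"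
        using own that unfolding nbhd_def by blast
    qed simp
    finally show ?thesis .
  qed
  moreover have "{j. j < ncli I \<and> \<sigma> j = None} = uncovered I \<tau> F"
    using dom unfolding dom_def uncovered_def by blast
  ultimately show feas: "feasible I F \<sigma>"
    using pack unc dom ran by (auto simp: feasible_def packing_def)
  show "cost I F \<sigma> \<le> 5 * \<tau>"
    unfolding cost_le_iff[OF feas] using near \<tau> by simp
qed

text \<open>The maximum defining the cost is a distance or the inserted 0. In the latter case some
  client is still served, since not all can be outliers, and its distance is then exactly 0.\<close>

lemma opt_cost_candidate:
  assumes "valid I" "feasible I S \<sigma>" "outliers I < ncli I"
  obtains i j where "i < nfac I" "j < ncli I" "opt_cost I = dst I (Fac i) (Cli j)"
proof -
  obtain S' \<sigma>' where opt: "feasible I S' \<sigma>'" "opt_cost I = cost I S' \<sigma>'"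
    using opt_cost_attained[OF assms(2)] .
  let ?C = "{dst I (Fac i) (Cli j) | i j. i \<in> S' \<and> j < ncli I \<and> \<sigma>' j = Some i}"
  have "\<exists>j<ncli I. \<sigma>' j \<noteq> None"
  proof (rule ccontr)
    assume "\<not> ?thesis"
    then have "{j. j < ncli I \<and> \<sigma>' j = None} = {..<ncli I}" by auto
    then show False
      using opt(1) assms(3) by (simp add: feasible_def)
  qed
  then obtain i j where ij: "\<sigma>' j = Some i" by auto
  note s = feasible_served[OF opt(1) ij]
  then have mem: "dst I (Fac i) (Cli j) \<in> ?C" using ij by blast
  have "cost I S' \<sigma>' \<in> insert 0 ?C"
    unfolding cost_def using finite_service[OF opt(1)] by (intro Max_in) auto
  moreover have "cost I S' \<sigma>' \<in> ?C" if "cost I S' \<sigma>' = 0"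
  proof -
    have "dst I (Fac i) (Cli j) \<le> cost I S' \<sigma>'"
      unfolding cost_def using mem finite_service[OF opt(1)] by (intro Max_ge) auto
    then show ?thesis
      using that mem valid_nonneg[OF assms(1), of "Fac i" "Cli j"] s by simp
  qed
  ultimately have "cost I S' \<sigma>' \<in> ?C" by blast
  then obtain x y where "\<sigma>' y = Some x" "cost I S' \<sigma>' = dst I (Fac x) (Cli y)"
    by blast
  then show ?thesis
    using that[of x y] opt(2) feasible_served[OF opt(1)] by metis
qed

lemma all_outliers:
  assumes "ncli I \<le> outliers I"
  shows "feasible I {} Map.empty" "cost I {} Map.empty = 0"
  using assms by (auto simp: feasible_def cost_def)

lemma opt_cost_nonneg: "feasible I S \<sigma> \<Longrightarrow> 0 \<le> opt_cost I"
  by (metis opt_cost_attained cost_le_nonneg order_refl)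

lemma solvable_opt_cost: "feasible I S \<sigma> \<Longrightarrow> solvable I (opt_cost I)"
  by (metis opt_cost_attained solvable_def order_refl)

section \<open>Reading the encoded instance\<close>

definition point_of :: "lbkso \<Rightarrow> nat \<Rightarrow> point" where
  "point_of I p = (if p < nfac I then Fac p else Cli (p - nfac I))"

lemma concat_map_nth:
  assumes "\<And>x. x \<in> set xs \<Longrightarrow> length (f x) = L" "p < length xs" "q < L"
  shows "concat (map f xs) ! (p * L + q) = f (xs ! p) ! q"
  using assms
proof (induction xs arbitrary: p)
  case (Cons x xs)
  then show ?case
    by (cases p) (auto simp: nth_append)
qed simp

lemma length_concat_map:
  "(\<And>x. x \<in> set xs \<Longrightarrow> length (f x) = L) \<Longrightarrow> length (concat (map f xs)) = length xs * L"
  by (induction xs) auto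

lemma length_encode_rat: "length (encode_rat r) = 2"
  by (simp add: encode_rat_def split: prod.split)

text \<open>\<open>encode_rat\<close> passes the numerator through \<open>nat\<close>, which is
  lossless only for nonnegative numbers.\<close>

lemma encode_rat_correct:
  assumes "0 \<le> r"
  shows "0 < encode_rat r ! 1" "of_nat (encode_rat r ! 0) / of_nat (encode_rat r ! 1) = r"
proof -
  obtain a b where ab: "quotient_of r = (a, b)"
    by (cases "quotient_of r")
  have b: "0 < b"
    using quotient_of_denom_pos[OF ab] .
  have r: "r = of_int a / of_int b"
    using quotient_of_div[OF ab] .
  then have "0 \<le> a"
    using assms b by (simp add: zero_le_divide_iff)
  then show "0 < encode_rat r ! 1" "of_nat (encode_rat r ! 0) / of_nat (encode_rat r ! 1) = r"
    using b by (simp_all add: encode_rat_def ab) (simp add: r)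
qed

context
  fixes I :: lbkso and ps :: "point list" and N :: nat
  defines "ps \<equiv> map Fac [0..<nfac I] @ map Cli [0..<ncli I]" and "N \<equiv> nfac I + ncli I"
begin

private lemma ps_nth: "p < N \<Longrightarrow> ps ! p = point_of I p"
  by (auto simp: ps_def N_def point_of_def nth_append)

private lemma length_ps: "length ps = N"
  by (simp add: ps_def N_def)

private lemma encode_alt:
  "encode I = [nfac I, ncli I, budget I, outliers I] @ map (lower I) [0..<nfac I] @
     concat (map (\<lambda>x. concat (map (\<lambda>y. encode_rat (dst I x y)) ps)) ps)"
  by (simp add: encode_def ps_def Let_def)

private lemma length_row: "length (concat (map (\<lambda>y. encode_rat (dst I x y)) ps)) = N * 2"
  by (subst length_concat_map[where L = 2]) (simp_all add: length_encode_rat length_ps)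

lemma length_encode: "length (encode I) = 4 + nfac I + N * (N * 2)"
  unfolding encode_alt
  by (simp add: length_concat_map[where L = "N * 2"] length_row length_ps)

lemma encode_header:
  "encode I ! 0 = nfac I" "encode I ! Suc 0 = ncli I" "encode I ! 2 = budget I"
  "encode I ! 3 = outliers I"
  by (simp_all add: encode_alt eval_nat_numeral)

lemma encode_lower: "i < nfac I \<Longrightarrow> encode I ! (4 + i) = lower I i"
  by (simp add: encode_alt nth_append)

text \<open>Row-major layout after four header cells and the lower bounds: each pair takes two
  cells, \<open>e = 0\<close> for the numerator and \<open>e = 1\<close> for the denominator. The
  range claim matters because \<open>init_mem\<close> is 0 beyond the input.\<close>

lemma encode_distance:
  assumes "p < N" "q < N" "e < 2"
  shows "encode I ! (4 + nfac I + 2 * (p * N + q) + e) = encode_rat (dst I (point_of I p) (point_of I q)) ! e"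
    and "4 + nfac I + 2 * (p * N + q) + e < length (encode I)"
proof -
  let ?row = "\<lambda>x. concat (map (\<lambda>y. encode_rat (dst I x y)) ps)"
  have e: "q * 2 + e < N * 2"
    using assms by linarith
  have "encode I ! (4 + nfac I + 2 * (p * N + q) + e) = concat (map ?row ps) ! (p * (N * 2) + (q * 2 + e))"
    by (simp add: encode_alt nth_append algebra_simps)
  also have "\<dots> = ?row (ps ! p) ! (q * 2 + e)"
    by (rule concat_map_nth) (use assms e in \<open>auto simp: length_row length_ps simp del: length_concat\<close>)
  also have "\<dots> = encode_rat (dst I (ps ! p) (ps ! q)) ! e"
    by (rule concat_map_nth) (use assms in \<open>auto simp: length_encode_rat length_ps\<close>)
  finally show "encode I ! (4 + nfac I + 2 * (p * N + q) + e) = encode_rat (dst I (point_of I p) (point_of I q)) ! e"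
    using assms by (simp add: ps_nth)
  have "p * (N * 2) + (q * 2 + e) < Suc p * (N * 2)"
    using e by simp
  also have "\<dots> \<le> N * (N * 2)"
    using assms by (intro mult_le_mono1) simp
  finally show "4 + nfac I + 2 * (p * N + q) + e < length (encode I)"
    by (simp add: length_encode algebra_simps)
qed

end

section \<open>Distance tests as machine expressions, and an invariant rule for loops\<close>

declare run.simps(5) [simp del]

definition radius :: "mem \<Rightarrow> rat" where
  "radius s = of_nat (s 5 0) / of_nat (s 6 0)"

definition loaded :: "lbkso \<Rightarrow> mem \<Rightarrow> bool" where
  "loaded I s \<longleftrightarrow> valid I \<and> s 0 = init_mem (encode I) 0"

lemma loaded_cells:
  assumes "loaded I s"
  shows "s 0 0 = nfac I" "s 0 (Suc 0) = ncli I" "s 0 2 = budget I" "s 0 3 = outliers I"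
    "i < nfac I \<Longrightarrow> s 0 (4 + i) = lower I i"
  using assms by (auto simp: loaded_def init_mem_def encode_header encode_lower length_encode)

abbreviation scalar :: "nat \<Rightarrow> aexp" where
  "scalar a \<equiv> Read a (Const 0)"

definition client :: "aexp \<Rightarrow> aexp" where
  "client e = Add (Read 0 (Const 0)) e"

definition numer :: "aexp \<Rightarrow> aexp \<Rightarrow> aexp" where
  "numer p q = Read 0 (Add (Add (Const 4) (Read 0 (Const 0)))
     (Mul (Const 2) (Add (Mul p (Add (Read 0 (Const 0)) (Read 0 (Const 1)))) q)))"

definition denom :: "aexp \<Rightarrow> aexp \<Rightarrow> aexp" where
  "denom p q = Read 0 (Add (Add (Add (Const 4) (Read 0 (Const 0)))
     (Mul (Const 2) (Add (Mul p (Add (Read 0 (Const 0)) (Read 0 (Const 1)))) q))) (Const 1))"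

text \<open>Division is avoided by cross-multiplication. Under truncated subtraction, x \<le> y
  holds iff 1 + y - x is nonzero, hence the \<open>Const 1\<close>.\<close>

definition near :: "nat \<Rightarrow> aexp \<Rightarrow> aexp \<Rightarrow> aexp" where
  "near k p q = Sub (Add (Const 1) (Mul (Mul (Const k) (scalar 5)) (denom p q))) (Mul (numer p q) (scalar 6))"

lemma aval_distance:
  assumes "loaded I s" "aval p s < nfac I + ncli I" "aval q s < nfac I + ncli I"
  shows "0 < aval (denom p q) s"
    and "of_nat (aval (numer p q) s) / of_nat (aval (denom p q) s) =
      dst I (point_of I (aval p s)) (point_of I (aval q s))"
proof -
  let ?d = "dst I (point_of I (aval p s)) (point_of I (aval q s))"
  have "0 \<le> ?d"
    using assms by (intro valid_nonneg) (auto simp: loaded_def point_of_def)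
  note d = encode_rat_correct[OF this]
  have "s 0 (4 + nfac I + 2 * (aval p s * (nfac I + ncli I) + aval q s) + e) = encode_rat ?d ! e" if "e < 2" for e
    using assms(1) encode_distance[OF assms(2,3) that] by (simp add: loaded_def init_mem_def)
  from this[of 0] this[of 1] have "aval (numer p q) s = encode_rat ?d ! 0" "aval (denom p q) s = encode_rat ?d ! 1"
    using loaded_cells[OF assms(1)] by (simp_all add: numer_def denom_def)
  then show "0 < aval (denom p q) s" "of_nat (aval (numer p q) s) / of_nat (aval (denom p q) s) = ?d"
    using d by simp_all
qed

lemma of_nat_divide_le_iff:
  assumes "0 < b" "0 < d"
  shows "(of_nat a / of_nat b :: rat) \<le> of_nat k * (of_nat c / of_nat d) \<longleftrightarrow> a * d \<le> k * c * b"
proof -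
  have "(of_nat a / of_nat b :: rat) \<le> of_nat k * (of_nat c / of_nat d) \<longleftrightarrow>
      (of_nat (a * d) :: rat) \<le> of_nat (k * c * b)"
    using assms by (simp add: field_simps)
  then show ?thesis
    by (simp only: of_nat_le_iff)
qed

lemma aval_near:
  assumes "loaded I s" "0 < s 6 0" "aval p s < nfac I + ncli I" "aval q s < nfac I + ncli I"
  shows "0 < aval (near k p q) s \<longleftrightarrow>
    dst I (point_of I (aval p s)) (point_of I (aval q s)) \<le> of_nat k * radius s"
proof -
  note d = aval_distance[OF assms(1,3,4)]
  show ?thesis
    unfolding d(2)[symmetric] radius_def of_nat_divide_le_iff[OF d(1) assms(2)]
    by (auto simp: near_def)
qed

lemma aval_near_fac:
  assumes "loaded I s" "0 < s 6 0" "aval p s < nfac I" "aval q s < nfac I"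
  shows "0 < aval (near k p q) s \<longleftrightarrow> dst I (Fac (aval p s)) (Fac (aval q s)) \<le> of_nat k * radius s"
  using aval_near[OF assms(1,2), of p q k] assms by (simp add: point_of_def)

lemma aval_near_cli:
  assumes "loaded I s" "0 < s 6 0" "aval p s < nfac I" "aval q s < ncli I"
  shows "0 < aval (near k p (client q)) s \<longleftrightarrow> dst I (Fac (aval p s)) (Cli (aval q s)) \<le> of_nat k * radius s"
  using aval_near[OF assms(1,2), of p "client q" k] assms loaded_cells[OF assms(1)]
  by (simp add: point_of_def client_def)

text \<open>\<open>P i u\<close> speaks of the state before the counter is set to \<open>i\<close>.
  The frame condition is supplied by the rule, so an invariant needs to mention only what the body
  changes.\<close>

lemma run_LFor:
  assumes "P 0 s"
    and step: "\<And>i u. i < s 0 b \<Longrightarrow> \<forall>a. a \<notin> insert v (writes c) \<longrightarrow> u a = s a \<Longrightarrow> P i u \<Longrightarrow>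
      P (Suc i) (run c (upd v 0 i u))"
  obtains u where "run (LFor v b c) s = upd v 0 (s 0 b) u"
    "\<forall>a. a \<notin> insert v (writes c) \<longrightarrow> u a = s a" "P (s 0 b) u"
proof -
  define w where "w n = fold (\<lambda>i s. run c (upd v 0 i s)) [0..<n] s" for n
  have "(\<forall>a. a \<notin> insert v (writes c) \<longrightarrow> w n a = s a) \<and> P n (w n)" if "n \<le> s 0 b" for n
    using that
  proof (induction n)
    case 0
    then show ?case
      using assms(1) by (simp add: w_def)
  next
    case (Suc n)
    have "w (Suc n) = run c (upd v 0 n (w n))"
      by (simp add: w_def)
    then show ?case
      using Suc step[of n "w n"] by (simp add: run_frame upd_other)
  qed
  then show ?thesis
    using that[of "w (s 0 b)"] by (simp add: w_def run.simps(5))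
qed

lemma card_less_Suc:
  "card {j. j < Suc k \<and> Q j} = card {j. j < k \<and> Q j} + (if Q k then 1 else 0)"
proof -
  have "{j. j < Suc k \<and> Q j} = (if Q k then insert k {j. j < k \<and> Q j} else {j. j < k \<and> Q j})"
    by (auto simp: less_Suc_eq)
  then show ?thesis
    by simp
qed

section \<open>The algorithm as a loop program\<close>

text \<open>
  Memory layout. Input: 0. Output: 1, 2, with the radius of the saved solution as the fraction
  19 / 20, where a zero denominator means that no solution has been saved. Current radius: the
  fraction 5 / 6, taken from the candidate pair (facility 3, client 4). Greedy packing: indicator 7,
  cardinality 8, round counter 9; best candidate 10 (index plus 1, or 0 if there is none) with
  gain 11 (plus 1). Loop variables: facility 12, client 13, facility 16. Scalars: neighbourhood size 14,
  eligibility flag 15. Tentative assignment 17 (encoded as in the output) with outlier count 18.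
\<close>

definition count_nbhd :: lprog where
  "count_nbhd = LSeq (LWrite 14 (Const 0) (Const 0))
     (LFor 13 1 (LCond (near 1 (scalar 12) (client (scalar 13)))
        (LWrite 14 (Const 0) (Add (scalar 14) (Const 1))) LSkip))"

lemma writes_count_nbhd [simp]: "writes count_nbhd = {13, 14}"
  by (auto simp: count_nbhd_def)

lemma run_count_nbhd:
  assumes s: "loaded I s" "0 < s 6 0" and i: "s 12 0 < nfac I"
  shows "run count_nbhd s 14 0 = card (nbhd I (radius s) (s 12 0))"
proof -
  define Q where "Q j \<longleftrightarrow> dst I (Fac (s 12 0)) (Cli j) \<le> radius s" for j
  define c where "c = LCond (near 1 (scalar 12) (client (scalar 13)))
        (LWrite 14 (Const 0) (Add (scalar 14) (Const 1))) LSkip"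
  have wr: "writes c = {14}"
    by (simp add: c_def)
  define s0 where "s0 = upd 14 0 0 s"
  obtain u where "run (LFor 13 1 c) s0 = upd 13 0 (s0 0 1) u" "u 14 0 = card {j. j < s0 0 1 \<and> Q j}"
  proof (rule run_LFor[where P = "\<lambda>k u. u 14 0 = card {j. j < k \<and> Q j}"])
    show "s0 14 0 = card {j. j < 0 \<and> Q j}"
      by (simp add: s0_def upd_apply)
  next
    fix k u
    assume k: "k < s0 0 1" and fr: "\<forall>a. a \<notin> insert 13 (writes c) \<longrightarrow> u a = s0 a"
      and u: "u 14 0 = card {j. j < k \<and> Q j}"
    let ?u = "upd 13 0 k u"
    have fr': "?u 0 = s 0" "?u 5 = s 5" "?u 6 = s 6" "?u 12 = s 12" "?u 13 0 = k" "?u 14 0 = u 14 0"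
      using fr by (simp_all add: wr s0_def upd_apply upd_other)
    then have "loaded I ?u" "0 < ?u 6 0" "radius ?u = radius s"
      using s by (simp_all add: loaded_def radius_def)
    then have "0 < aval (near 1 (scalar 12) (client (scalar 13))) ?u \<longleftrightarrow> Q k"
      using aval_near_cli[of I ?u "scalar 12" "scalar 13" 1] i k loaded_cells[OF s(1)] fr'
      by (simp add: Q_def s0_def upd_other)
    then show "run c ?u 14 0 = card {j. j < Suc k \<and> Q j}"
      using fr' u unfolding card_less_Suc by (simp add: c_def upd_apply)
  qed
  moreover have "{j. j < ncli I \<and> Q j} = nbhd I (radius s) (s 12 0)"
    by (simp add: nbhd_def Q_def)
  ultimately show ?thesis
    using loaded_cells[OF s(1)] by (simp add: count_nbhd_def s0_def c_def upd_apply upd_other)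
qed

definition chosen :: "lbkso \<Rightarrow> mem \<Rightarrow> nat set" where
  "chosen I s = {i. i < nfac I \<and> s 7 i \<noteq> 0}"

text \<open>In tests, products act as conjunctions and sums as disjunctions; the first difference is
  nonzero exactly when the lower bound exceeds the neighbourhood size.\<close>

definition check_addable :: lprog where
  "check_addable = LSeq (LWrite 15 (Const 0) (Const 1))
     (LSeq (LCond (Sub (Read 0 (Add (Const 4) (scalar 12))) (scalar 14)) (LWrite 15 (Const 0) (Const 0)) LSkip)
     (LFor 16 0 (LCond (Mul (Read 7 (scalar 16)) (near 4 (scalar 12) (scalar 16)))
        (LWrite 15 (Const 0) (Const 0)) LSkip)))"

lemma writes_check_addable [simp]: "writes check_addable = {15, 16}"
  by (auto simp: check_addable_def)

lemma run_check_addable: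
  assumes s: "loaded I s" "0 < s 6 0" and i: "s 12 0 < nfac I"
    and g: "s 14 0 = card (nbhd I (radius s) (s 12 0))"
  shows "0 < run check_addable s 15 0 \<longleftrightarrow> s 12 0 \<in> addable I (radius s) (chosen I s)"
proof -
  define Q where "Q h \<longleftrightarrow> 0 < s 7 h \<and> dst I (Fac (s 12 0)) (Fac h) \<le> 4 * radius s" for h
  define B where "B \<longleftrightarrow> lower I (s 12 0) \<le> card (nbhd I (radius s) (s 12 0))"
  define c where "c = LCond (Mul (Read 7 (scalar 16)) (near 4 (scalar 12) (scalar 16)))
        (LWrite 15 (Const 0) (Const 0)) LSkip"
  have wr: "writes c = {15}"
    by (simp add: c_def)
  define s0 where "s0 = run (LCond (Sub (Read 0 (Add (Const 4) (scalar 12))) (scalar 14)) (LWrite 15 (Const 0) (Const 0)) LSkip)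
    (upd 15 0 1 s)"
  have s0: "a \<noteq> 15 \<Longrightarrow> s0 a = s a" "0 < s0 15 0 \<longleftrightarrow> B" for a
    using loaded_cells(5)[OF s(1) i] g by (auto simp: s0_def upd_apply upd_other B_def)
  obtain u where "run (LFor 16 0 c) s0 = upd 16 0 (s0 0 0) u" "0 < u 15 0 \<longleftrightarrow> B \<and> (\<forall>h<s0 0 0. \<not> Q h)"
  proof (rule run_LFor[where P = "\<lambda>k u. 0 < u 15 0 \<longleftrightarrow> B \<and> (\<forall>h<k. \<not> Q h)"])
    show "0 < s0 15 0 \<longleftrightarrow> B \<and> (\<forall>h<0. \<not> Q h)"
      by (simp add: s0)
  next
    fix k u
    assume k: "k < s0 0 0" and fr: "\<forall>a. a \<notin> insert 16 (writes c) \<longrightarrow> u a = s0 a"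
      and u: "0 < u 15 0 \<longleftrightarrow> B \<and> (\<forall>h<k. \<not> Q h)"
    let ?u = "upd 16 0 k u"
    have fr': "?u 0 = s 0" "?u 5 = s 5" "?u 6 = s 6" "?u 7 = s 7" "?u 12 = s 12" "?u 16 0 = k" "?u 15 0 = u 15 0"
      using fr by (simp_all add: wr s0 upd_apply upd_other)
    then have "loaded I ?u" "0 < ?u 6 0" "radius ?u = radius s"
      using s by (simp_all add: loaded_def radius_def)
    then have "0 < aval (Mul (Read 7 (scalar 16)) (near 4 (scalar 12) (scalar 16))) ?u \<longleftrightarrow> Q k"
      using aval_near_fac[of I ?u "scalar 12" "scalar 16" 4] i k loaded_cells[OF s(1)] fr'
      by (simp add: Q_def s0)
    then show "0 < run c ?u 15 0 \<longleftrightarrow> B \<and> (\<forall>h<Suc k. \<not> Q h)"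
      using fr' u by (simp add: c_def upd_apply less_Suc_eq) blast
  qed
  moreover have "run check_addable s = run (LFor 16 0 c) s0"
    by (simp add: check_addable_def c_def s0_def)
  ultimately have "0 < run check_addable s 15 0 \<longleftrightarrow> B \<and> (\<forall>h<nfac I. \<not> Q h)"
    using loaded_cells[OF s(1)] by (simp add: upd_apply s0)
  then show ?thesis
    using i by (auto simp: addable_def B_def Q_def chosen_def not_le)
qed

lemma radius_nonneg: "0 \<le> radius s"
  by (simp add: radius_def)

text \<open>The gain is stored plus 1, with 0 for none, so the single test
  \<open>g \<le> card (nbhd I \<tau> k)\<close> accepts a first candidate even with an empty
  neighbourhood and later ones only if strictly larger.\<close>

definition best_upto :: "lbkso \<Rightarrow> rat \<Rightarrow> nat set \<Rightarrow> nat \<Rightarrow> nat \<Rightarrow> nat \<Rightarrow> bool" where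
  "best_upto I \<tau> F k b g \<longleftrightarrow>
     (b = 0 \<and> g = 0 \<and> (\<forall>i\<in>addable I \<tau> F. k \<le> i)) \<or>
     (\<exists>i\<in>addable I \<tau> F. b = Suc i \<and> g = Suc (card (nbhd I \<tau> i)) \<and>
        (\<forall>i'\<in>addable I \<tau> F. i' < k \<longrightarrow> card (nbhd I \<tau> i') \<le> card (nbhd I \<tau> i)))"

lemma best_upto_step:
  assumes "best_upto I \<tau> F k b g"
  shows "best_upto I \<tau> F (Suc k)
    (if k \<in> addable I \<tau> F \<and> g \<le> card (nbhd I \<tau> k) then Suc k else b)
    (if k \<in> addable I \<tau> F \<and> g \<le> card (nbhd I \<tau> k) then Suc (card (nbhd I \<tau> k)) else g)"
proof (cases "k \<in> addable I \<tau> F \<and> g \<le> card (nbhd I \<tau> k)")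
  case True
  have "card (nbhd I \<tau> i') \<le> card (nbhd I \<tau> k)" if "i' \<in> addable I \<tau> F" "i' < Suc k" for i'
    using assms that True by (force simp: best_upto_def less_Suc_eq)
  then show ?thesis
    using True by (simp add: best_upto_def)
next
  case False
  have "best_upto I \<tau> F (Suc k) b g"
    using assms unfolding best_upto_def
  proof (elim disjE)
    assume b: "b = 0 \<and> g = 0 \<and> (\<forall>i\<in>addable I \<tau> F. k \<le> i)"
    with False have "\<forall>i\<in>addable I \<tau> F. Suc k \<le> i"
      by (metis Suc_leI bot_nat_0.extremum le_neq_implies_less)
    with b show "(b = 0 \<and> g = 0 \<and> (\<forall>i\<in>addable I \<tau> F. Suc k \<le> i)) \<or> (\<exists>i\<in>addable I \<tau> F. b = Suc i \<and> g = Suc (card (nbhd I \<tau> i)) \<and>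
        (\<forall>i'\<in>addable I \<tau> F. i' < Suc k \<longrightarrow> card (nbhd I \<tau> i') \<le> card (nbhd I \<tau> i)))"
      by blast
  next
    assume "\<exists>i\<in>addable I \<tau> F. b = Suc i \<and> g = Suc (card (nbhd I \<tau> i)) \<and>
        (\<forall>i'\<in>addable I \<tau> F. i' < k \<longrightarrow> card (nbhd I \<tau> i') \<le> card (nbhd I \<tau> i))"
    then obtain i where i: "i \<in> addable I \<tau> F" "b = Suc i" "g = Suc (card (nbhd I \<tau> i))"
        "\<forall>i'\<in>addable I \<tau> F. i' < k \<longrightarrow> card (nbhd I \<tau> i') \<le> card (nbhd I \<tau> i)"
      by blast
    then have "\<forall>i'\<in>addable I \<tau> F. i' < Suc k \<longrightarrow> card (nbhd I \<tau> i') \<le> card (nbhd I \<tau> i)"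
      using False by (auto simp: less_Suc_eq)
    with i show "(b = 0 \<and> g = 0 \<and> (\<forall>i\<in>addable I \<tau> F. Suc k \<le> i)) \<or> (\<exists>i\<in>addable I \<tau> F. b = Suc i \<and> g = Suc (card (nbhd I \<tau> i)) \<and>
        (\<forall>i'\<in>addable I \<tau> F. i' < Suc k \<longrightarrow> card (nbhd I \<tau> i') \<le> card (nbhd I \<tau> i)))"
      by blast
  qed
  then show ?thesis
    using False by auto
qed

definition scan_facility :: lprog where
  "scan_facility = LSeq count_nbhd (LSeq check_addable
     (LCond (Mul (scalar 15) (Sub (Add (Const 1) (scalar 14)) (scalar 11)))
       (LSeq (LWrite 10 (Const 0) (Add (scalar 12) (Const 1))) (LWrite 11 (Const 0) (Add (scalar 14) (Const 1))))
       LSkip))"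

lemma writes_scan_facility [simp]: "writes scan_facility = {10, 11, 13, 14, 15, 16}"
  by (auto simp: scan_facility_def)

lemma run_scan_facility:
  assumes s: "loaded I s" "0 < s 6 0" and i: "s 12 0 = i" "i < nfac I"
    and \<tau>: "\<tau> = radius s" "F = chosen I s"
  shows "run scan_facility s 10 0 =
      (if i \<in> addable I \<tau> F \<and> s 11 0 \<le> card (nbhd I \<tau> i) then Suc i else s 10 0)"
    and "run scan_facility s 11 0 =
      (if i \<in> addable I \<tau> F \<and> s 11 0 \<le> card (nbhd I \<tau> i) then Suc (card (nbhd I \<tau> i)) else s 11 0)"
proof -
  define s1 where "s1 = run count_nbhd s"
  define s2 where "s2 = run check_addable s1"
  have fr1: "a \<notin> {13, 14} \<Longrightarrow> s1 a = s a" for a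
    by (simp add: s1_def run_frame)
  have fr2: "a \<notin> {15, 16} \<Longrightarrow> s2 a = s1 a" for a
    by (simp add: s2_def run_frame)
  have g: "s1 14 0 = card (nbhd I \<tau> i)"
    using run_count_nbhd[OF s] i \<tau> by (simp add: s1_def)
  have eqs: "loaded I s1" "0 < s1 6 0" "radius s1 = \<tau>" "chosen I s1 = F"
    using s by (simp_all add: \<tau> fr1 loaded_def radius_def chosen_def)
  have "0 < s2 15 0 \<longleftrightarrow> i \<in> addable I \<tau> F"
    using run_check_addable[OF eqs(1,2)] i g eqs by (simp add: s2_def fr1)
  moreover have "run scan_facility s =
    run (LCond (Mul (scalar 15) (Sub (Add (Const 1) (scalar 14)) (scalar 11)))
       (LSeq (LWrite 10 (Const 0) (Add (scalar 12) (Const 1))) (LWrite 11 (Const 0) (Add (scalar 14) (Const 1))))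
       LSkip) s2"
    by (simp add: scan_facility_def s1_def s2_def)
  ultimately show "run scan_facility s 10 0 =
      (if i \<in> addable I \<tau> F \<and> s 11 0 \<le> card (nbhd I \<tau> i) then Suc i else s 10 0)"
    and "run scan_facility s 11 0 =
      (if i \<in> addable I \<tau> F \<and> s 11 0 \<le> card (nbhd I \<tau> i) then Suc (card (nbhd I \<tau> i)) else s 11 0)"
    using i g by (auto simp: upd_apply fr1 fr2)
qed

definition search_best :: lprog where
  "search_best = LSeq (LWrite 10 (Const 0) (Const 0)) (LSeq (LWrite 11 (Const 0) (Const 0))
     (LFor 12 0 scan_facility))"

lemma writes_search_best [simp]: "writes search_best = {10, 11, 12, 13, 14, 15, 16}"
  by (auto simp: search_best_def)

lemma run_search_best:
  assumes s: "loaded I s" "0 < s 6 0"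
  shows "best_upto I (radius s) (chosen I s) (nfac I) (run search_best s 10 0) (run search_best s 11 0)"
proof -
  define s0 where "s0 = upd 11 0 0 (upd 10 0 0 s)"
  let ?P = "\<lambda>k u. best_upto I (radius s) (chosen I s) k (u 10 0) (u 11 0)"
  obtain u where "run (LFor 12 0 scan_facility) s0 = upd 12 0 (s0 0 0) u" "?P (s0 0 0) u"
  proof (rule run_LFor[where P = ?P])
    show "?P 0 s0"
      by (simp add: s0_def upd_apply best_upto_def)
  next
    fix k u
    assume k: "k < s0 0 0" and fr: "\<forall>a. a \<notin> insert 12 (writes scan_facility) \<longrightarrow> u a = s0 a"
      and u: "?P k u"
    let ?u = "upd 12 0 k u"
    have fr': "?u 0 = s 0" "?u 5 = s 5" "?u 6 = s 6" "?u 7 = s 7" "?u 12 0 = k" "?u 10 0 = u 10 0" "?u 11 0 = u 11 0"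
      using fr by (simp_all add: s0_def upd_apply upd_other)
    have k': "k < nfac I"
      using k loaded_cells[OF s(1)] by (simp add: s0_def upd_other)
    have "loaded I ?u" "0 < ?u 6 0" "radius s = radius ?u" "chosen I s = chosen I ?u"
      using fr' s by (simp_all add: loaded_def radius_def chosen_def)
    note r = run_scan_facility[OF this(1,2) fr'(5) k' this(3,4)]
    show "?P (Suc k) (run scan_facility ?u)"
      unfolding r fr' using u by (rule best_upto_step)
  qed
  then show ?thesis
    using loaded_cells[OF s(1)] by (simp add: search_best_def s0_def upd_apply upd_other)
qed

definition greedy_round :: lprog where
  "greedy_round = LSeq search_best
     (LCond (Mul (scalar 10) (Sub (Read 0 (Const 2)) (scalar 8)))
       (LSeq (LWrite 7 (Sub (scalar 10) (Const 1)) (Const 1)) (LWrite 8 (Const 0) (Add (scalar 8) (Const 1))))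
       LSkip)"

lemma writes_greedy_round [simp]: "writes greedy_round = {7, 8, 10, 11, 12, 13, 14, 15, 16}"
  by (auto simp: greedy_round_def)

lemma run_greedy_round:
  assumes s: "loaded I s" "0 < s 6 0" and card: "s 8 0 = card (chosen I s)"
  shows "greedy_step I (radius s) (chosen I s) (chosen I (run greedy_round s))"
    and "run greedy_round s 8 0 = card (chosen I (run greedy_round s))"
proof -
  define s1 where "s1 = run search_best s"
  define \<tau> F where "\<tau> = radius s" and "F = chosen I s"
  have fr: "a \<notin> {10, 11, 12, 13, 14, 15, 16} \<Longrightarrow> s1 a = s a" for a
    by (simp add: s1_def run_frame)
  have F: "chosen I s1 = F" "s1 8 0 = card F"
    using card by (simp_all add: F_def fr chosen_def)
  have best: "best_upto I \<tau> F (nfac I) (s1 10 0) (s1 11 0)"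
    using run_search_best[OF s] by (simp add: s1_def \<tau>_def F_def)
  have lt: "i < nfac I" if "i \<in> addable I \<tau> F" for i
    using that by (simp add: addable_def)
  have run: "run greedy_round s = (if 0 < s1 10 0 \<and> card F < budget I
      then upd 8 0 (Suc (card F)) (upd 7 (s1 10 0 - 1) 1 s1) else s1)"
    using loaded_cells[OF s(1)] F by (simp add: greedy_round_def fr upd_apply flip: s1_def)
  have "greedy_step I \<tau> F (chosen I (run greedy_round s)) \<and>
      run greedy_round s 8 0 = card (chosen I (run greedy_round s))"
  proof (cases "0 < s1 10 0 \<and> card F < budget I")
    case True
    then obtain i where i: "i \<in> addable I \<tau> F" "s1 10 0 = Suc i"
        "\<forall>i'\<in>addable I \<tau> F. card (nbhd I \<tau> i') \<le> card (nbhd I \<tau> i)"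
      using best lt by (auto simp: best_upto_def)
    have "chosen I (run greedy_round s) = insert i F"
      using True i lt[OF i(1)] F(1) by (auto simp: run chosen_def upd_apply)
    moreover have "i \<notin> F"
      using i(1) valid_refl[of I "Fac i"] s(1) radius_nonneg[of s]
      by (fastforce simp: addable_def loaded_def \<tau>_def)
    moreover have "finite F"
      by (simp add: F_def chosen_def)
    ultimately show ?thesis
      using True i run by (auto simp: greedy_step_def upd_apply)
  next
    case False
    then have "addable I \<tau> F = {} \<or> budget I \<le> card F"
      using best lt by (fastforce simp: best_upto_def)
    moreover have "run greedy_round s = s1"
      using False by (auto simp: run)
    ultimately show ?thesis
      using F by (simp add: greedy_step_def)
  qed
  then show "greedy_step I (radius s) (chosen I s) (chosen I (run greedy_round s))"
    and "run greedy_round s 8 0 = card (chosen I (run greedy_round s))"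
    by (simp_all add: \<tau>_def F_def)
qed

text \<open>Array 7 is cleared first because it may hold the packing of the previous radius.\<close>

definition greedy :: lprog where
  "greedy = LSeq (LFor 12 0 (LWrite 7 (scalar 12) (Const 0))) (LSeq (LWrite 8 (Const 0) (Const 0))
     (LFor 9 0 greedy_round))"

lemma writes_greedy [simp]: "writes greedy = {7, 8, 9, 10, 11, 12, 13, 14, 15, 16}"
  by (auto simp: greedy_def)

lemma run_greedy:
  assumes s: "loaded I s" "0 < s 6 0"
  shows "greedy_inv I (radius s) (nfac I) (chosen I (run greedy s))"
proof -
  let ?c = "LWrite 7 (scalar 12) (Const 0)"
  obtain u where u: "run (LFor 12 0 ?c) s = upd 12 0 (s 0 0) u"
      "\<forall>a. a \<notin> insert 12 (writes ?c) \<longrightarrow> u a = s a" "\<forall>i<s 0 0. u 7 i = 0"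
    by (rule run_LFor[where P = "\<lambda>k u. \<forall>i<k. u 7 i = 0" and c = ?c and v = 12 and b = 0 and s = s])
      (auto simp: upd_apply less_Suc_eq)
  define s0 where "s0 = upd 8 0 0 (upd 12 0 (s 0 0) u)"
  have s0: "s0 0 = s 0" "s0 5 = s 5" "s0 6 = s 6" "chosen I s0 = {}" "s0 8 0 = 0"
    using u(2,3) loaded_cells[OF s(1)] by (auto simp: s0_def upd_other upd_apply chosen_def)
  let ?P = "\<lambda>k u. greedy_inv I (radius s) k (chosen I u) \<and> u 8 0 = card (chosen I u)"
  obtain w where "run (LFor 9 0 greedy_round) s0 = upd 9 0 (s0 0 0) w" "?P (s0 0 0) w"
  proof (rule run_LFor[where P = ?P])
    show "?P 0 s0"
      by (simp add: s0 greedy_inv_init)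
  next
    fix k u
    assume k: "k < s0 0 0" and fr: "\<forall>a. a \<notin> insert 9 (writes greedy_round) \<longrightarrow> u a = s0 a" and u: "?P k u"
    let ?u = "upd 9 0 k u"
    have fr': "?u 0 = s 0" "?u 5 = s 5" "?u 6 = s 6" "?u 7 = u 7" "?u 8 = u 8"
      using fr by (simp_all add: s0 upd_apply upd_other)
    then have eqs: "loaded I ?u" "0 < ?u 6 0" "radius ?u = radius s" "chosen I ?u = chosen I u"
      using s by (simp_all add: loaded_def radius_def chosen_def)
    have "?u 8 0 = card (chosen I ?u)"
      using u fr' eqs by simp
    note r = run_greedy_round[OF eqs(1,2) this]
    show "?P (Suc k) (run greedy_round ?u)"
      using greedy_inv_step[OF _ radius_nonneg _ r(1)] r(2) u eqs s(1) by (simp add: loaded_def)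
  qed
  moreover have "run greedy s = run (LFor 9 0 greedy_round) s0"
    by (simp add: greedy_def u(1) s0_def)
  ultimately show ?thesis
    using loaded_cells[OF s(1)] s0 by (simp add: chosen_def upd_other)
qed

section \<open>Assigning the covered clients\<close>

definition served :: "lbkso \<Rightarrow> rat \<Rightarrow> nat set \<Rightarrow> nat \<Rightarrow> nat \<Rightarrow> nat \<Rightarrow> bool" where
  "served I \<tau> F k j a \<longleftrightarrow>
     (a = 0 \<longrightarrow> (\<forall>i\<in>F. i < k \<longrightarrow> 5 * \<tau> < dst I (Fac i) (Cli j))) \<and>
     (\<forall>i. a = Suc i \<longrightarrow> i \<in> F \<and> dst I (Fac i) (Cli j) \<le> 5 * \<tau>) \<and>
     (\<forall>i\<in>F. i < k \<longrightarrow> dst I (Fac i) (Cli j) \<le> \<tau> \<longrightarrow> a = Suc i)"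

lemma servedD:
  assumes "served I \<tau> F k j a"
  shows "a = 0 \<Longrightarrow> i \<in> F \<Longrightarrow> i < k \<Longrightarrow> 5 * \<tau> < dst I (Fac i) (Cli j)"
    and "a = Suc i \<Longrightarrow> i \<in> F" "a = Suc i \<Longrightarrow> dst I (Fac i) (Cli j) \<le> 5 * \<tau>"
    and "i \<in> F \<Longrightarrow> i < k \<Longrightarrow> dst I (Fac i) (Cli j) \<le> \<tau> \<Longrightarrow> a = Suc i"
  using assms unfolding served_def by blast+

text \<open>A common client would place the two chosen facilities within 2\<tau>, hence within
  4\<tau>, of each other.\<close>

lemma packing_unique_owner:
  assumes val: "valid I" and \<tau>: "0 \<le> \<tau>" and pack: "packing I \<tau> F"
    and x: "x \<in> F" "dst I (Fac x) (Cli j) \<le> \<tau>" and y: "y \<in> F" "dst I (Fac y) (Cli j) \<le> \<tau>"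
    and j: "j < ncli I"
  shows "x = y"
proof (rule ccontr)
  assume "x \<noteq> y"
  have F: "x < nfac I" "y < nfac I"
    using pack x y by (auto simp: packing_def)
  have "dst I (Fac x) (Fac y) \<le> dst I (Fac x) (Cli j) + dst I (Cli j) (Fac y)"
    by (rule valid_triangle) (use val F j in auto)
  also have "dst I (Cli j) (Fac y) = dst I (Fac y) (Cli j)"
    by (rule valid_sym) (use val F j in auto)
  finally have "dst I (Fac x) (Fac y) \<le> 4 * \<tau>"
    using x y \<tau> by simp
  then show False
    using pack x y \<open>x \<noteq> y\<close> by (force simp: packing_def)
qed

lemma served_step:
  assumes val: "valid I" and \<tau>: "0 \<le> \<tau>" and pack: "packing I \<tau> F" and j: "j < ncli I"
    and a: "served I \<tau> F k j a"
    and a': "a' = (if k \<in> F \<and> dst I (Fac k) (Cli j) \<le> 5 * \<tau> \<and> (a = 0 \<or> dst I (Fac k) (Cli j) \<le> \<tau>) then Suc k else a)"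
  shows "served I \<tau> F (Suc k) j a'"
proof -
  have "a' = Suc i" if "i \<in> F" "i < Suc k" "dst I (Fac i) (Cli j) \<le> \<tau>" for i
  proof (cases "i = k")
    case True
    then show ?thesis
      using that \<tau> by (simp add: a')
  next
    case False
    then have "a = Suc i"
      using that by (intro servedD(4)[OF a]) auto
    \<comment> \<open>An overwrite of a nonempty entry requires \<open>j\<close> in the
      neighbourhood of \<open>k\<close>; as the owner is unique, it can displace only a facility
      that is not the owner.\<close>
    moreover have "\<not> (k \<in> F \<and> dst I (Fac k) (Cli j) \<le> \<tau>)"
      using packing_unique_owner[OF val \<tau> pack _ _ that(1,3) j, of k] False by blast
    ultimately show ?thesis
      by (auto simp: a')
  qed
  moreover have "5 * \<tau> < dst I (Fac i) (Cli j)" if "a' = 0" "i \<in> F" "i < Suc k" for i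
  proof -
    have "a = 0" "\<not> (k \<in> F \<and> dst I (Fac k) (Cli j) \<le> 5 * \<tau>)"
      using that(1) by (simp_all add: a' split: if_splits)
    then show ?thesis
      using that servedD(1)[OF a, of i] by (cases "i = k") simp_all
  qed
  moreover have "i \<in> F \<and> dst I (Fac i) (Cli j) \<le> 5 * \<tau>" if "a' = Suc i" for i
  proof (cases "a = Suc i")
    case True
    then show ?thesis
      using servedD(2,3)[OF a] by blast
  next
    case False
    with that show ?thesis
      by (simp add: a' split: if_splits)
  qed
  ultimately show ?thesis
    unfolding served_def by blast
qed

definition try_facility :: lprog where
  "try_facility = LCond (Mul (Read 7 (scalar 12)) (near 5 (scalar 12) (client (scalar 13))))
     (LCond (Add (Sub (Const 1) (Read 17 (scalar 13))) (near 1 (scalar 12) (client (scalar 13))))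
        (LWrite 17 (scalar 13) (Add (scalar 12) (Const 1))) LSkip)
     LSkip"

lemma writes_try_facility [simp]: "writes try_facility = {17}"
  by (simp add: try_facility_def)

definition serve_client :: lprog where
  "serve_client = LSeq (LWrite 17 (scalar 13) (Const 0)) (LFor 12 0 try_facility)"

lemma writes_serve_client [simp]: "writes serve_client = {12, 17}"
  by (auto simp: serve_client_def)

lemma run_serve_client:
  assumes s: "loaded I s" "0 < s 6 0" and j: "s 13 0 < ncli I"
    and pack: "packing I (radius s) (chosen I s)"
  shows "served I (radius s) (chosen I s) (nfac I) (s 13 0) (run serve_client s 17 (s 13 0))"
    and "j \<noteq> s 13 0 \<Longrightarrow> run serve_client s 17 j = s 17 j"
proof -
  let ?\<tau> = "radius s" and ?F = "chosen I s" and ?j = "s 13 0"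
  define s0 where "s0 = upd 17 ?j 0 s"
  let ?P = "\<lambda>k u. served I ?\<tau> ?F k ?j (u 17 ?j) \<and> (\<forall>j. j \<noteq> ?j \<longrightarrow> u 17 j = s 17 j)"
  obtain u where "run (LFor 12 0 try_facility) s0 = upd 12 0 (s0 0 0) u" "?P (s0 0 0) u"
  proof (rule run_LFor[where P = ?P])
    show "?P 0 s0"
      by (simp add: s0_def upd_apply served_def)
  next
    fix k u
    assume k: "k < s0 0 0" and fr: "\<forall>a. a \<notin> insert 12 (writes try_facility) \<longrightarrow> u a = s0 a" and u: "?P k u"
    let ?u = "upd 12 0 k u"
    have fr': "?u 0 = s 0" "?u 5 = s 5" "?u 6 = s 6" "?u 7 = s 7" "?u 13 = s 13" "?u 12 0 = k" "?u 17 = u 17"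
      using fr by (simp_all add: s0_def upd_apply upd_other)
    have k': "k < nfac I"
      using k loaded_cells[OF s(1)] by (simp add: s0_def upd_other)
    have eqs: "loaded I ?u" "0 < ?u 6 0" "radius ?u = ?\<tau>"
      using fr' s by (simp_all add: loaded_def radius_def)
    have near: "0 < aval (near c (scalar 12) (client (scalar 13))) ?u \<longleftrightarrow> dst I (Fac k) (Cli ?j) \<le> of_nat c * ?\<tau>" for c
      using aval_near_cli[OF eqs(1,2), of "scalar 12" "scalar 13" c] k' j fr' eqs by simp
    have "k \<in> ?F \<longleftrightarrow> 0 < s 7 k"
      using k' by (simp add: chosen_def)
    then have "run try_facility ?u 17 ?j = (if k \<in> ?F \<and> dst I (Fac k) (Cli ?j) \<le> 5 * ?\<tau> \<and>
        (u 17 ?j = 0 \<or> dst I (Fac k) (Cli ?j) \<le> ?\<tau>) then Suc k else u 17 ?j)"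
      using fr' near[of 5] near[of 1] by (auto simp: try_facility_def upd_apply)
    from served_step[OF _ radius_nonneg pack j _ this] u s(1)
    have "served I ?\<tau> ?F (Suc k) ?j (run try_facility ?u 17 ?j)"
      by (simp add: loaded_def)
    moreover have "\<forall>j. j \<noteq> ?j \<longrightarrow> run try_facility ?u 17 j = s 17 j"
      using u fr' by (simp add: try_facility_def upd_apply)
    ultimately show "?P (Suc k) (run try_facility ?u)"
      by blast
  qed
  then show "served I (radius s) (chosen I s) (nfac I) (s 13 0) (run serve_client s 17 (s 13 0))"
    and "j \<noteq> s 13 0 \<Longrightarrow> run serve_client s 17 j = s 17 j"
    using loaded_cells[OF s(1)] by (simp_all add: serve_client_def s0_def upd_apply upd_other)
qed

definition assign :: lprog where
  "assign = LSeq (LWrite 18 (Const 0) (Const 0)) (LFor 13 1 (LSeq serve_client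
     (LCond (Read 17 (scalar 13)) LSkip (LWrite 18 (Const 0) (Add (scalar 18) (Const 1))))))"

lemma writes_assign [simp]: "writes assign = {12, 13, 17, 18}"
  by (auto simp: assign_def)

text \<open>The reading of \<open>out_assign\<close> for an arbitrary array, so that it applies to
  the tentative assignment before copying.\<close>

definition decode :: "lbkso \<Rightarrow> (nat \<Rightarrow> nat) \<Rightarrow> (nat \<rightharpoonup> nat)" where
  "decode I a = (\<lambda>j. if j < ncli I \<and> a j \<noteq> 0 then Some (a j - 1) else None)"

lemma run_assign:
  assumes s: "loaded I s" "0 < s 6 0" and pack: "packing I (radius s) (chosen I s)"
  shows "assigned I (radius s) (chosen I s) (decode I (run assign s 17))"
    and "run assign s 18 0 = card (uncovered I (radius s) (chosen I s))"
proof -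
  let ?\<tau> = "radius s" and ?F = "chosen I s"
  define c where "c = LSeq serve_client
     (LCond (Read 17 (scalar 13)) LSkip (LWrite 18 (Const 0) (Add (scalar 18) (Const 1))))"
  have wr: "writes c = {12, 17, 18}"
    by (auto simp: c_def)
  define s0 where "s0 = upd 18 0 0 s"
  let ?P = "\<lambda>k u. (\<forall>j<k. served I ?\<tau> ?F (nfac I) j (u 17 j)) \<and> u 18 0 = card {j. j < k \<and> u 17 j = 0}"
  obtain u where run: "run (LFor 13 1 c) s0 = upd 13 0 (s0 0 1) u" and u: "?P (s0 0 1) u"
  proof (rule run_LFor[where P = ?P])
    show "?P 0 s0"
      by (simp add: s0_def upd_apply)
  next
    fix k u
    assume k: "k < s0 0 1" and fr: "\<forall>a. a \<notin> insert 13 (writes c) \<longrightarrow> u a = s0 a" and u: "?P k u"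
    let ?u = "upd 13 0 k u"
    let ?w = "run serve_client ?u"
    have fr': "?u 0 = s 0" "?u 5 = s 5" "?u 6 = s 6" "?u 7 = s 7" "?u 13 0 = k" "?u 17 = u 17" "?u 18 = u 18"
      using fr by (simp_all add: s0_def upd_apply upd_other wr)
    have k': "k < ncli I"
      using k loaded_cells[OF s(1)] by (simp add: s0_def upd_other)
    have eqs: "loaded I ?u" "0 < ?u 6 0" "radius ?u = ?\<tau>" "chosen I ?u = ?F"
      using fr' s by (simp_all add: loaded_def radius_def chosen_def)
    have "?u 13 0 < ncli I" "packing I (radius ?u) (chosen I ?u)"
      using k' pack eqs fr'(5) by simp_all
    note serve = run_serve_client[OF eqs(1,2) this]
    have w: "served I ?\<tau> ?F (nfac I) k (?w 17 k)" "j \<noteq> k \<Longrightarrow> ?w 17 j = u 17 j" for j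
      using serve(1) serve(2)[of j] fr' eqs by simp_all
    have w': "?w 18 0 = u 18 0" "?w 13 0 = k"
      using fr' by (simp_all add: run_frame)
    have r17: "run c ?u 17 = ?w 17"
      by (auto simp: c_def upd_other)
    have "{j. j < k \<and> ?w 17 j = 0} = {j. j < k \<and> u 17 j = 0}"
      using w(2) by auto
    then have "run c ?u 18 0 = card {j. j < Suc k \<and> run c ?u 17 j = 0}"
      using u w' unfolding card_less_Suc r17 by (simp add: c_def upd_apply)
    moreover have "\<forall>j<Suc k. served I ?\<tau> ?F (nfac I) j (run c ?u 17 j)"
      unfolding r17 using w u by (auto simp: less_Suc_eq)
    ultimately show "?P (Suc k) (run c ?u)"
      by blast
  qed
  have fin: "run assign s = upd 13 0 (s0 0 1) u"
    using run by (simp add: assign_def c_def s0_def)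
  have m: "s0 0 1 = ncli I"
    using loaded_cells[OF s(1)] by (simp add: s0_def upd_other)
  have F: "i \<in> ?F \<Longrightarrow> i < nfac I" for i
    by (simp add: chosen_def)
  have sv: "served I ?\<tau> ?F (nfac I) j (u 17 j)" if "j < ncli I" for j
    using u m that by simp
  have cov: "u 17 j = 0 \<longleftrightarrow> j \<in> uncovered I ?\<tau> ?F" if "j < ncli I" for j
  proof -
    note served = servedD[OF sv[OF that]]
    show ?thesis
    proof (cases "u 17 j")
      case 0
      then show ?thesis
        using served(1) F that by (simp add: uncovered_def)
    next
      case (Suc i)
      then have "j \<notin> uncovered I ?\<tau> ?F"
        using served(2,3)[of i] by (force simp: uncovered_def)
      then show ?thesis
        using Suc by simp
    qed
  qed
  show "run assign s 18 0 = card (uncovered I (radius s) (chosen I s))"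
  proof -
    have "j < ncli I" if "j \<in> uncovered I ?\<tau> ?F" for j
      using that by (simp add: uncovered_def)
    then have "{j. j < ncli I \<and> u 17 j = 0} = uncovered I ?\<tau> ?F"
      using cov by blast
    then show ?thesis
      using u m by (simp add: fin upd_other)
  qed
  have "j \<in> dom (decode I (u 17)) \<longleftrightarrow> j \<in> {..<ncli I} - uncovered I ?\<tau> ?F" for j
    using cov[of j] by (auto simp: decode_def dom_def)
  then have "dom (decode I (u 17)) = {..<ncli I} - uncovered I ?\<tau> ?F"
    by blast
  moreover have "i \<in> ?F \<and> dst I (Fac i) (Cli j) \<le> 5 * ?\<tau>" if "decode I (u 17) j = Some i" for i j
  proof -
    have "j < ncli I" "u 17 j = Suc i"
      using that by (auto simp: decode_def split: if_splits)
    then show ?thesis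
      using servedD(2,3)[OF sv] by blast
  qed
  moreover have "decode I (u 17) j = Some i" if "i \<in> ?F" "j \<in> nbhd I ?\<tau> i" for i j
  proof -
    have j: "j < ncli I" "dst I (Fac i) (Cli j) \<le> ?\<tau>"
      using that(2) by (simp_all add: nbhd_def)
    then have "u 17 j = Suc i"
      by (intro servedD(4)[OF sv] that(1) F[OF that(1)])
    then show ?thesis
      using j by (simp add: decode_def)
  qed
  ultimately show "assigned I (radius s) (chosen I s) (decode I (run assign s 17))"
    unfolding assigned_def fin upd_other[of 17 13, simplified] by blast
qed

section \<open>Keeping the best solution over all candidate radii\<close>

definition save_solution :: lprog where
  "save_solution = LSeq (LFor 12 0 (LWrite 1 (scalar 12) (Read 7 (scalar 12))))
     (LSeq (LFor 13 1 (LWrite 2 (scalar 13) (Read 17 (scalar 13))))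
     (LSeq (LWrite 19 (Const 0) (scalar 5)) (LWrite 20 (Const 0) (scalar 6))))"

lemma writes_save_solution [simp]: "writes save_solution = {1, 2, 12, 13, 19, 20}"
  by (auto simp: save_solution_def)

lemma run_save_solution:
  assumes s: "loaded I s"
  shows "out_set I (run save_solution s) = chosen I s"
    and "out_assign I (run save_solution s) = decode I (s 17)"
    and "run save_solution s 19 0 = s 5 0" "run save_solution s 20 0 = s 6 0"
proof -
  note m = loaded_cells[OF s]
  let ?c = "LWrite 1 (scalar 12) (Read 7 (scalar 12))"
  obtain u where u: "run (LFor 12 0 ?c) s = upd 12 0 (s 0 0) u"
      "\<forall>a. a \<notin> insert 12 (writes ?c) \<longrightarrow> u a = s a" "(\<forall>i<s 0 0. u 1 i = s 7 i)"
    by (rule run_LFor[where P = "\<lambda>k u. \<forall>i<k. u 1 i = s 7 i" and c = ?c and v = 12 and b = 0 and s = s])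
      (auto simp: upd_apply less_Suc_eq)
  define s1 where "s1 = upd 12 0 (s 0 0) u"
  have s1: "a \<notin> {1, 12} \<Longrightarrow> s1 a = s a" "s1 1 = u 1" for a
    using u(2) by (simp_all add: s1_def upd_other)
  let ?d = "LWrite 2 (scalar 13) (Read 17 (scalar 13))"
  obtain w where w: "run (LFor 13 1 ?d) s1 = upd 13 0 (s1 0 1) w"
      "\<forall>a. a \<notin> insert 13 (writes ?d) \<longrightarrow> w a = s1 a" "\<forall>j<s1 0 1. w 2 j = s1 17 j"
    by (rule run_LFor[where P = "\<lambda>k w. \<forall>j<k. w 2 j = s1 17 j" and c = ?d and v = 13 and b = 1 and s = s1])
      (auto simp: upd_apply less_Suc_eq)
  have w': "a \<notin> {1, 2, 12, 13} \<Longrightarrow> w a = s a" "w 1 = u 1" for a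
    using w(2) s1 by simp_all
  have run: "run save_solution s = upd 20 0 (s 6 0) (upd 19 0 (s 5 0) (upd 13 0 (s1 0 1) w))"
    by (simp add: save_solution_def u(1)[unfolded One_nat_def] w(1)[unfolded One_nat_def] w'
        upd_apply flip: s1_def)
  show "run save_solution s 19 0 = s 5 0" "run save_solution s 20 0 = s 6 0"
    by (simp_all add: run upd_apply)
  show "out_set I (run save_solution s) = chosen I s"
    using u(3) w'(2) m by (auto simp: run out_set_def chosen_def upd_other)
  show "out_assign I (run save_solution s) = decode I (s 17)"
    using w(3) s1(1) m by (auto simp: run out_assign_def decode_def upd_other fun_eq_iff)
qed

definition record_solution :: lprog where
  "record_solution = LCond (Sub (Add (Const 1) (Read 0 (Const 3))) (scalar 18))
     (LCond (Add (Sub (Const 1) (scalar 20))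
         (Sub (Mul (scalar 19) (scalar 6)) (Mul (scalar 5) (scalar 20))))
        save_solution LSkip)
     LSkip"

definition try_radius :: lprog where
  "try_radius =
     LSeq (LWrite 5 (Const 0) (numer (scalar 3) (client (scalar 4))))
    (LSeq (LWrite 6 (Const 0) (denom (scalar 3) (client (scalar 4))))
    (LSeq greedy (LSeq assign record_solution)))"

lemma writes_record_solution [simp]: "writes record_solution = {1, 2, 12, 13, 19, 20}"
  by (simp add: record_solution_def)

lemma writes_try_radius [simp]:
  "writes try_radius = {1, 2, 5, 6, 7, 8, 9, 10, 11, 12, 13, 14, 15, 16, 17, 18, 19, 20}"
  by (auto simp: try_radius_def)

text \<open>\<open>T\<close> collects the radii tried so far. The saved radius need not be solvable:
  it suffices that a solution within 5 times it was found and that no solvable radius in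
  \<open>T\<close> is smaller.\<close>

definition best_for :: "lbkso \<Rightarrow> rat set \<Rightarrow> mem \<Rightarrow> bool" where
  "best_for I T s \<longleftrightarrow>
     (if s 20 0 = 0 then \<forall>\<tau>\<in>T. \<not> solvable I \<tau>
      else feasible I (out_set I s) (out_assign I s) \<and>
        cost I (out_set I s) (out_assign I s) \<le> 5 * (of_nat (s 19 0) / of_nat (s 20 0)) \<and>
        (\<forall>\<tau>\<in>T. solvable I \<tau> \<longrightarrow> of_nat (s 19 0) / of_nat (s 20 0) \<le> \<tau>))"

lemma of_nat_divide_less_iff:
  assumes "0 < b" "0 < d"
  shows "(of_nat c / of_nat d :: rat) < of_nat a / of_nat b \<longleftrightarrow> c * b < a * d"
  using of_nat_divide_le_iff[OF assms, of a 1 c] by (simp add: not_le flip: linorder_not_le)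

lemma best_for_cong:
  "u 1 = s 1 \<Longrightarrow> u 2 = s 2 \<Longrightarrow> u 19 = s 19 \<Longrightarrow> u 20 = s 20 \<Longrightarrow> best_for I T u = best_for I T s"
  by (simp add: best_for_def out_set_def out_assign_def cong: if_cong)

lemma run_record_solution:
  assumes s: "loaded I s" "0 < s 6 0" and best: "best_for I T s"
    and inv: "greedy_inv I (radius s) (nfac I) (chosen I s)"
    and asg: "assigned I (radius s) (chosen I s) (decode I (s 17))"
    and unc: "s 18 0 = card (uncovered I (radius s) (chosen I s))"
  shows "best_for I (insert (radius s) T) (run record_solution s)"
proof (cases "s 18 0 \<le> outliers I \<and> (s 20 0 = 0 \<or> s 5 0 * s 20 0 < s 19 0 * s 6 0)")
  case True
  have val: "valid I"
    using s(1) by (simp add: loaded_def)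
  have "packing I (radius s) (chosen I s)"
    using inv by (simp add: greedy_inv_def)
  note sol = assigned_solution[OF val radius_nonneg this _ asg]
  have run: "run record_solution s = run save_solution s"
    using True loaded_cells[OF s(1)] by (auto simp: record_solution_def)
  have less: "radius s < of_nat (s 19 0) / of_nat (s 20 0)" if "s 20 0 \<noteq> 0"
    using True that s(2) by (simp add: radius_def of_nat_divide_less_iff)
  have "radius s \<le> \<tau>" if "\<tau> \<in> T" "solvable I \<tau>" for \<tau>
    using best that less by (fastforce simp: best_for_def split: if_splits)
  then show ?thesis
    using sol True unc s(2) unfolding best_for_def run run_save_solution[OF s(1)]
    by (auto simp: radius_def)
next
  case False
  have "run record_solution s = s"
    using False loaded_cells[OF s(1)] by (auto simp: record_solution_def)
  \<comment> \<open>At a solvable radius the outlier test succeeds by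
    \<open>greedy_inv_final\<close>, so only the comparison with an already saved radius can have
    prevented saving.\<close>
  moreover have "s 20 0 \<noteq> 0 \<and> of_nat (s 19 0) / of_nat (s 20 0) \<le> radius s" if "solvable I (radius s)"
  proof -
    have "card (uncovered I (radius s) (chosen I s)) \<le> outliers I"
      using greedy_inv_final[OF _ radius_nonneg inv that] s(1) by (simp add: loaded_def)
    then have "s 20 0 \<noteq> 0" "\<not> s 5 0 * s 20 0 < s 19 0 * s 6 0"
      using False unc by auto
    then show ?thesis
      using of_nat_divide_less_iff[of "s 20 0" "s 6 0" "s 5 0" "s 19 0"] s(2) by (simp add: radius_def not_less)
  qed
  ultimately show ?thesis
    using best by (auto simp: best_for_def split: if_splits)
qed

lemma run_try_radius:
  assumes s: "loaded I s" and ij: "s 3 0 = i" "s 4 0 = j" "i < nfac I" "j < ncli I"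
    and best: "best_for I T s"
  shows "best_for I (insert (dst I (Fac i) (Cli j)) T) (run try_radius s)"
proof -
  note m = loaded_cells[OF s]
  define s1 where "s1 = upd 6 0 (aval (denom (scalar 3) (client (scalar 4))) s)
    (upd 5 0 (aval (numer (scalar 3) (client (scalar 4))) s) s)"
  define s2 where "s2 = run greedy s1"
  define s3 where "s3 = run assign s2"
  have run: "run try_radius s = run record_solution s3"
    by (simp add: try_radius_def s3_def s2_def s1_def denom_def client_def upd_other)
  have "aval (scalar 3) s < nfac I + ncli I" "aval (client (scalar 4)) s < nfac I + ncli I"
    using ij m by (simp_all add: client_def)
  note d = aval_distance[OF s this]
  have \<tau>: "radius s1 = dst I (Fac i) (Cli j)" "0 < s1 6 0"
    using d ij m by (simp_all add: radius_def s1_def upd_apply point_of_def client_def)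
  have fr: "a \<notin> {5, 6} \<Longrightarrow> s1 a = s a"
    "a \<notin> {7, 8, 9, 10, 11, 12, 13, 14, 15, 16} \<Longrightarrow> s2 a = s1 a"
    "a \<notin> {12, 13, 17, 18} \<Longrightarrow> s3 a = s2 a" for a
    by (simp_all add: s1_def s2_def s3_def upd_other run_frame)
  have eqs: "loaded I s1" "loaded I s2" "0 < s2 6 0" "radius s2 = radius s1"
    "loaded I s3" "0 < s3 6 0" "radius s3 = radius s1" "chosen I s3 = chosen I s2"
    using s \<tau>(2) by (simp_all add: loaded_def radius_def chosen_def fr)
  have inv: "greedy_inv I (radius s3) (nfac I) (chosen I s3)"
    using run_greedy[OF eqs(1) \<tau>(2)] eqs by (simp add: s2_def)
  then have pack: "packing I (radius s2) (chosen I s2)"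
    using eqs by (simp add: greedy_inv_def)
  have "best_for I T s3"
    using best best_for_cong[of s3 s] fr by simp
  then have "best_for I (insert (radius s3) T) (run record_solution s3)"
    using run_assign[OF eqs(2,3) pack] eqs
    by (intro run_record_solution[OF eqs(5,6) _ inv]) (simp_all add: s3_def)
  then show ?thesis
    using eqs \<tau>(1) by (simp add: run)
qed

text \<open>If all clients may be outliers, the optimum 0 need not be a facility-client distance;
  the untouched output arrays then encode the empty solution, which is optimal.\<close>

definition approx_alg :: lprog where
  "approx_alg = LCond (Sub (Read 0 (Const 1)) (Read 0 (Const 3))) (LFor 3 0 (LFor 4 1 try_radius)) LSkip"

lemma run_candidates:
  assumes s: "loaded I s" and best: "best_for I {} s"
  shows "best_for I {dst I (Fac i) (Cli j) | i j. i < nfac I \<and> j < ncli I} (run (LFor 3 0 (LFor 4 1 try_radius)) s)"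
proof -
  note m = loaded_cells[OF s]
  let ?T = "\<lambda>k. {dst I (Fac i) (Cli j) | i j. i < k \<and> j < ncli I}"
  let ?P = "\<lambda>k u. best_for I (?T k) u"
  obtain u where "run (LFor 3 0 (LFor 4 1 try_radius)) s = upd 3 0 (s 0 0) u" "?P (s 0 0) u"
  proof (rule run_LFor[where P = ?P])
    show "?P 0 s"
      using best by simp
  next
    fix k u
    assume k: "k < s 0 0" and fr: "\<forall>a. a \<notin> insert 3 (writes (LFor 4 1 try_radius)) \<longrightarrow> u a = s a" and u: "?P k u"
    define u0 where "u0 = upd 3 0 k u"
    have u0: "loaded I u0" "u0 3 0 = k" "best_for I (?T k) u0"
      using fr s u best_for_cong[of u0 u] by (simp_all add: u0_def upd_apply upd_other loaded_def)
    \<comment> \<open>All earlier rows of candidate pairs, and the first \<open>l\<close> entries of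
      row \<open>k\<close>.\<close>
    let ?S = "\<lambda>l. ?T k \<union> {dst I (Fac k) (Cli j) | j. j < l}"
    let ?Q = "\<lambda>l w. best_for I (?S l) w"
    obtain w where "run (LFor 4 1 try_radius) u0 = upd 4 0 (u0 0 1) w" "?Q (u0 0 1) w"
    proof (rule run_LFor[where P = ?Q])
      show "?Q 0 u0"
        using u0(3) by simp
    next
      fix l w
      assume l: "l < u0 0 1" and fr: "\<forall>a. a \<notin> insert 4 (writes try_radius) \<longrightarrow> w a = u0 a" and w: "?Q l w"
      define w0 where "w0 = upd 4 0 l w"
      have w0: "loaded I w0" "w0 3 0 = k" "w0 4 0 = l" "?Q l w0"
        using fr u0 w best_for_cong[of w0 w] by (simp_all add: w0_def upd_apply upd_other loaded_def)
      have kl: "k < nfac I" "l < ncli I"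
        using k l m loaded_cells[OF u0(1)] by simp_all
      have "?S (Suc l) = insert (dst I (Fac k) (Cli l)) (?S l)"
        by (auto simp: less_Suc_eq)
      then show "?Q (Suc l) (run try_radius (upd 4 0 l w))"
        using run_try_radius[OF w0(1-3) kl w0(4)] by (simp add: w0_def)
    qed
    moreover have "?S (ncli I) = ?T (Suc k)"
      by (auto simp: less_Suc_eq)
    ultimately show "?P (Suc k) (run (LFor 4 1 try_radius) (upd 3 0 k u))"
      using loaded_cells[OF u0(1)] best_for_cong[of "upd 4 0 (ncli I) w" w]
      by (simp add: upd_other flip: u0_def)
  qed
  then show ?thesis
    using m best_for_cong[of "upd 3 0 (nfac I) u" u] by (simp add: upd_other)
qed

text \<open>The optimum is a solvable candidate, so a radius has been saved and is at most the
  optimum, while the saved solution costs at most 5 times that radius.\<close>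

lemma run_approx_alg:
  assumes val: "valid I" and feas: "feasible I S \<sigma>"
    and s: "s = run approx_alg (init_mem (encode I))"
  shows "feasible I (out_set I s) (out_assign I s) \<and>
    cost I (out_set I s) (out_assign I s) \<le> 5 * opt_cost I"
proof -
  let ?s0 = "init_mem (encode I)"
  have ld: "loaded I ?s0"
    using val by (simp add: loaded_def)
  note m = loaded_cells[OF ld]
  have zero: "?s0 a i = 0" if "a \<noteq> 0" for a i
    using that by (simp add: init_mem_def)
  show ?thesis
  proof (cases "ncli I \<le> outliers I")
    case True
    then have "s = ?s0"
      using m by (simp add: s approx_alg_def)
    then have "out_set I s = {}" "out_assign I s = Map.empty"
      by (auto simp: out_set_def out_assign_def zero)
    then show ?thesis
      using all_outliers[OF True] opt_cost_nonneg[OF feas] by simp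
  next
    case False
    then obtain i j where ij: "i < nfac I" "j < ncli I" "opt_cost I = dst I (Fac i) (Cli j)"
      using opt_cost_candidate[OF val feas] by auto
    have "best_for I {} ?s0"
      by (simp add: best_for_def zero)
    from run_candidates[OF ld this] False m
    have "best_for I {dst I (Fac i) (Cli j) | i j. i < nfac I \<and> j < ncli I} s"
      by (simp add: s approx_alg_def)
    moreover have "opt_cost I \<in> {dst I (Fac i) (Cli j) | i j. i < nfac I \<and> j < ncli I}"
      using ij by blast
    ultimately have "feasible I (out_set I s) (out_assign I s)"
        "cost I (out_set I s) (out_assign I s) \<le> 5 * (of_nat (s 19 0) / of_nat (s 20 0))"
        "of_nat (s 19 0) / of_nat (s 20 0) \<le> opt_cost I"
      using solvable_opt_cost[OF feas] unfolding best_for_def by (meson | metis)+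
    then show ?thesis
      by linarith
  qed
qed

section \<open>Polynomial running time in the input size\<close>

lemma wf_approx_alg: "wf_prog approx_alg"
  by (simp add: approx_alg_def try_radius_def record_solution_def save_solution_def assign_def
      serve_client_def try_facility_def greedy_def greedy_round_def search_best_def
      scan_facility_def check_addable_def count_nbhd_def numer_def denom_def)

lemma lprog_poly_time_input:
  assumes "wf_prog c"
  shows "\<exists>p :: nat poly. \<forall>xs. xs ! 0 \<le> sum_list (map len xs) \<longrightarrow> xs ! 1 \<le> sum_list (map len xs) \<longrightarrow>
    1 < length xs \<longrightarrow>
    (\<exists>t \<le> poly p (sum_list (map len xs)). exec (compile c) (init_mem xs) t (run c (init_mem xs)))"
proof -
  obtain g q :: "nat poly" where
    q: "(\<forall>a i. run c s a i \<le> M + poly g X) \<and> (\<exists>t \<le> poly q (X + len M). exec (compile c) s t (run c s))"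
    if "s 0 0 \<le> X" "s 0 1 \<le> X" "X \<le> M" "\<forall>a i. s a i \<le> M" for s X M
    using lprog_poly_time[OF assms] by metis
  have "\<exists>t \<le> poly (pcompose q [:1, 3:]) X. exec (compile c) (init_mem xs) t (run c (init_mem xs))"
    if X: "X = sum_list (map len xs)" and xs: "xs ! 0 \<le> X" "xs ! 1 \<le> X" "1 < length xs" for xs X
  proof -
    \<comment> \<open>The summand \<open>X\<close> ensures \<open>X \<le> M\<close>. Then
      \<open>len M\<close> is at most \<open>2 * X + 1\<close>, which gives the argument
      \<open>[:1, 3:]\<close>.\<close>
    define M where "M = Max (set xs) + X"
    have "xs \<noteq> []"
      using xs by auto
    then have "Max (set xs) \<in> set xs"
      by (intro Max_in) auto
    then have "len (Max (set xs)) \<le> X"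
      unfolding X by (intro member_le_sum_list) auto
    then have len: "X + len M \<le> poly [:1, 3:] X"
      using len_add_le[of "Max (set xs)" X] by (simp add: M_def)
    have "init_mem xs a i \<le> M" for a i
      by (auto simp: init_mem_def M_def intro: trans_le_add1)
    then have "\<exists>t \<le> poly q (X + len M). exec (compile c) (init_mem xs) t (run c (init_mem xs))"
      using q[of "init_mem xs" X M] xs by (simp add: init_mem_def M_def)
    then show ?thesis
      using poly_nat_mono[OF len, of q] by (auto simp: poly_pcompose intro: order_trans)
  qed
  then show ?thesis by blast
qed

text \<open>Although these counts are written in binary, the input contains entries for every pair
  of points, each of length at least 1, so it is at least as long as the number of points.\<close>

lemma encode_header_le:
  "nfac I \<le> input_size I" "ncli I \<le> input_size I"
proof -
  have "sum_list (map (\<lambda>_. 1) xs) \<le> sum_list (map len xs)" for xs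
    by (intro sum_list_mono len_pos)
  then have "length (encode I) \<le> input_size I"
    by (simp add: input_size_def sum_list_triv)
  moreover have "n \<le> n * (n * 2)" for n :: nat
    by simp
  then have "nfac I + ncli I \<le> length (encode I)"
    using le_add2 order_trans unfolding length_encode by blast
  ultimately show "nfac I \<le> input_size I" "ncli I \<le> input_size I"
    by linarith+
qed

theorem mainTheorem4:
  shows "\<exists>(P :: com) (p :: nat poly). \<forall>I :: lbkso. valid I \<longrightarrow>
    (\<exists>t s. exec P (init_mem (encode I)) t s \<and>
           t \<le> poly p (input_size I) \<and>
           ((\<exists>S \<sigma>. feasible I S \<sigma>) \<longrightarrow>
              feasible I (out_set I s) (out_assign I s) \<and>
              cost I (out_set I s) (out_assign I s) \<le> 5 * opt_cost I))"
proof -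
  obtain p :: "nat poly" where p:
    "\<exists>t \<le> poly p (sum_list (map len xs)). exec (compile approx_alg) (init_mem xs) t (run approx_alg (init_mem xs))"
    if "xs ! 0 \<le> sum_list (map len xs)" "xs ! 1 \<le> sum_list (map len xs)" "1 < length xs" for xs
    using lprog_poly_time_input[OF wf_approx_alg] by metis
  show ?thesis
  proof (intro exI[of _ "compile approx_alg"] exI[of _ p] allI impI)
    fix I assume val: "valid I"
    have "\<exists>t \<le> poly p (input_size I). exec (compile approx_alg) (init_mem (encode I)) t
        (run approx_alg (init_mem (encode I)))"
      unfolding input_size_def
      by (rule p) (use encode_header_le[of I] in \<open>simp_all add: encode_header input_size_def length_encode\<close>)
    then show "\<exists>t s. exec (compile approx_alg) (init_mem (encode I)) t s \<and> t \<le> poly p (input_size I) \<and>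
        ((\<exists>S \<sigma>. feasible I S \<sigma>) \<longrightarrow> feasible I (out_set I s) (out_assign I s) \<and>
          cost I (out_set I s) (out_assign I s) \<le> 5 * opt_cost I)"
      using run_approx_alg[OF val _ refl] by blast
  qed
qed

end
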